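(* Let $I=[0,T]$ with $T>0$, let $0<t_1<t_2<\ldots<t_n\leqslant T$ be arbitrary but fixed, and let $\alpha_1,\ldots,\alpha_n\in\mathbb{R}$ satisfy $\sum_{i=1}^n|\alpha_i|\leqslant 1$ and $\sum_{i=1}^n\alpha_i\neq 1$. Let $F\colon I\times\mathbb{R}^N\multimap\mathbb{R}^N$ be a Carathéodory map and suppose there exists a monotone coercive weakly negatively guiding potential $V\colon\mathbb{R}^N\to\mathbb{R}$ for $F$. Then the nonlocal initial value problem $$\dot{x}(t)\in F(t,x(t))\ \text{ for a.e. } t\in I,\qquad x(0)=\sum_{i=1}^n\alpha_i x(t_i)$$ possesses at least one solution $x\in AC(I,\mathbb{R}^N)$.
   Context: $AC(I,\mathbb{R}^N)$ is the space of absolutely continuous functions $I\to\mathbb{R}^N$; solutions are absolutely continuous functions. $|\cdot|$ and $\langle\cdot,\cdot\rangle$ are the Euclidean norm and inner product in $\mathbb{R}^N$. A multivalued map $F\colon X\multimap Z$ assigns to each $x\in X$ a nonempty subset $F(x)\subset Z$. Carathéodory map: $F\colon I\times\mathbb{R}^N\multimap\mathbb{R}^N$ with nonempty convex compact values such that ($F_1$) for every fixed $x\in\mathbb{R}^N$ the multimap $t\mapsto F(t,x)$ is measurable, i.e. $\{t\in I\colon F(t,x)\subset A\}$ is Lebesgue measurable for every closed $A\subset\mathbb{R}^N$; ($F_2$) for a.e. $t\in I$ the multimap $x\mapsto F(t,x)$ is upper semicontinuous; ($F_3$) there is $\mu\in L^1(I,\mathbb{R})$ with $\sup\{|y|\colon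 y\in F(t,x)\}\leqslant\mu(t)(1+|x|)$ for every $(t,x)\in I\times\mathbb{R}^N$. $V$ is monotone if $|x|\leqslant|y|$ implies $V(x)\leqslant V(y)$ for all $x,y\in\mathbb{R}^N$. $V$ is coercive if $V(x)\to+\infty$ as $|x|\to+\infty$. Weakly negatively guiding potential for $F$: $V\in C^1(\mathbb{R}^N,\mathbb{R})$ which is nonsingular, i.e. there is $R>0$ with $\nabla V(x)\neq 0$ for all $|x|\geqslant R$, and such that there is $R>0$ such that for all $|x|\geqslant R$ and all $t\in I$ there exists $y\in F(t,x)$ with $\langle\nabla V(x),y\rangle\leqslant 0$. *)

theory Defs
  imports "HOL-Analysis.Analysis"
begin

text \<open>
  Multimaps \<open>I \<times> \<real>\<^sup>N \<multimap> \<real>\<^sup>N\<close> are total set-valued functions on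
  \<open>real \<times> \<real>\<^sup>N\<close>; every condition is imposed for times in \<open>I\<close> only, so that the values
  outside \<open>I\<close> are irrelevant.
\<close>

definition upper_semicontinuous ::
    "('a::topological_space \<Rightarrow> 'b::topological_space set) \<Rightarrow> bool" where
  "upper_semicontinuous G \<longleftrightarrow> (\<forall>U. open U \<longrightarrow> open {x. G x \<subseteq> U})"

definition caratheodory_map ::
    "real set \<Rightarrow> (real \<Rightarrow> real^'n \<Rightarrow> (real^'n) set) \<Rightarrow> bool" where
  "caratheodory_map I F \<longleftrightarrow>
     (\<forall>t\<in>I. \<forall>x. F t x \<noteq> {} \<and> convex (F t x) \<and> compact (F t x)) \<and>
     (\<forall>x A. closed A \<longrightarrow> {t\<in>I. F t x \<subseteq> A} \<in> sets lebesgue) \<and>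
     (AE t in lebesgue_on I. upper_semicontinuous (F t)) \<and>
     (\<exists>\<mu>. integrable (lebesgue_on I) \<mu> \<and>
        (\<forall>t\<in>I. \<forall>x. (SUP y\<in>F t x. norm y) \<le> \<mu> t * (1 + norm x)))"

text \<open>The \<open>\<epsilon>\<close>-\<open>\<delta>\<close> definition of absolute continuity (not to be confused with the library's
  absolute continuity of measures): \<open>D\<close> ranges over the finite families of non-overlapping
  compact intervals contained in \<open>I\<close>, and \<open>Inf K\<close>, \<open>Sup K\<close> are the end points of \<open>K\<close>.\<close>

definition abs_continuous_on :: "real set \<Rightarrow> (real \<Rightarrow> 'a::real_normed_vector) \<Rightarrow> bool" where
  "abs_continuous_on I f \<longleftrightarrow>
     (\<forall>\<epsilon>>0. \<exists>\<delta>>0. \<forall>D S. D division_of S \<and> S \<subseteq> I \<and> (\<Sum>K\<in>D. measure lborel K) < \<delta> \<longrightarrow>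
        (\<Sum>K\<in>D. norm (f (Sup K) - f (Inf K))) < \<epsilon>)"

definition gradient :: "('a::real_inner \<Rightarrow> real) \<Rightarrow> 'a \<Rightarrow> 'a" where
  "gradient V x = (THE d. GDERIV V x :> d)"

lemma gradient_eqI:
  assumes "GDERIV V x :> d"
  shows "gradient V x = d"
  unfolding gradient_def
proof (rule the_equality, rule assms)
  fix d' assume "GDERIV V x :> d'"
  then have "(\<lambda>h. h \<bullet> d') = (\<lambda>h. h \<bullet> d)"
    using assms unfolding gderiv_def by (rule has_derivative_unique)
  then have "\<forall>h. h \<bullet> d' = h \<bullet> d"
    by (rule fun_cong[THEN allI])
  then show "d' = d"
    by (simp only: vector_eq_ldot)
qed

definition C1 :: "(real^'n \<Rightarrow> real) \<Rightarrow> bool" where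
  "C1 V \<longleftrightarrow> (\<forall>x. V differentiable at x) \<and> continuous_on UNIV (gradient V)"

definition nonsingular :: "(real^'n \<Rightarrow> real) \<Rightarrow> bool" where
  "nonsingular V \<longleftrightarrow> (\<exists>R>0. \<forall>x. norm x \<ge> R \<longrightarrow> gradient V x \<noteq> 0)"

definition weakly_negatively_guiding ::
    "real set \<Rightarrow> (real \<Rightarrow> real^'n \<Rightarrow> (real^'n) set) \<Rightarrow> (real^'n \<Rightarrow> real) \<Rightarrow> bool" where
  "weakly_negatively_guiding I F V \<longleftrightarrow>
     C1 V \<and> nonsingular V \<and>
     (\<exists>R>0. \<forall>x. norm x \<ge> R \<longrightarrow> (\<forall>t\<in>I. \<exists>y\<in>F t x. gradient V x \<bullet> y \<le> 0))"

definition monotone_potential :: "(real^'n \<Rightarrow> real) \<Rightarrow> bool" where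
  "monotone_potential V \<longleftrightarrow> (\<forall>x y. norm x \<le> norm y \<longrightarrow> V x \<le> V y)"

definition coercive :: "(real^'n \<Rightarrow> real) \<Rightarrow> bool" where
  "coercive V \<longleftrightarrow> filterlim V at_top at_infinity"

definition solves_inclusion ::
    "real set \<Rightarrow> (real \<Rightarrow> real^'n \<Rightarrow> (real^'n) set) \<Rightarrow> (real \<Rightarrow> real^'n) \<Rightarrow> bool" where
  "solves_inclusion I F x \<longleftrightarrow>
     (AE t in lebesgue_on I. \<exists>y\<in>F t (x t). (x has_vector_derivative y) (at t within I))"

end

theory Submission
  imports Defs "HOL-Complex_Analysis.Great_Picard"
begin

text \<open>
  A monotone \<open>V\<close> is radial, so outside a ball its gradient is a positive multiple of \<open>x\<close> and
  the guiding condition reads: some \<open>y \<in> F(t,x)\<close> satisfies \<open>\<langle>x, y\<rangle> \<le> 0\<close>. Gluing measurable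
  selections with this property by a partition of unity gives a right-hand side that is continuous
  in \<open>x\<close>, almost selects \<open>F\<close> and almost points inwards on a large sphere. Its Euler polygons
  depend continuously on the initial value \<open>x\<^sub>0\<close> and almost stay in the ball; as
  \<open>\<Sum> |\<alpha>\<^sub>i| \<le> 1\<close>, the map sending \<open>x\<^sub>0\<close> to the projection of \<open>\<Sum> \<alpha>\<^sub>i x(t\<^sub>i)\<close> onto the ball has a fixed
  point by Brouwer's theorem. The resulting approximate solutions converge uniformly along a subsequence
  by Arzela-Ascoli, iterated midpoints of their derivatives converge almost everywhere, and
  convexity and upper semicontinuity put the limit of the derivatives into \<open>F(t, x(t))\<close>.
\<close>

section \<open>Lebesgue differentiation in dimension one\<close>

text \<open>Only some values of \<open>F\<close> need point inwards, so a solution of the inclusion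
  starting in the ball may leave it; the bound has to be built into the approximations. Errors of
  order \<open>\<delta>\<close> arise from gluing selections taken at nearby points, from freezing
  the argument along an Euler step and from overshooting the sphere. The sphere has radius
  \<open>R + 1\<close>, so that all points contributing to the glued right-hand side there still lie
  where the guiding condition holds. Overshooting is the reason for projecting the nonlocal
  condition: the combination of values of a polygon may lie slightly outside the ball. In the limit
  the trajectory stays in the ball, the bound on the coefficients keeps the combination there, and
  the projection becomes the identity. Euler polygons are single-valued in the initial value, so
  Brouwer's theorem is enough although the set of solutions of the inclusion is in general neither a
  singleton nor convex.\<close>

text \<open>The intervals witnessing a large deviation are selected disjointly by Vitali's theorem and then
  form a tagged partial division, to which Henstock's lemma applies.\<close>

lemma negligible_nondifferentiability_indefinite_integral:
  fixes f :: "real \<Rightarrow> 'b::euclidean_space"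
  assumes f: "f integrable_on {a..b}" and "\<eta> > 0"
  defines "B \<equiv> {t \<in> {a<..<b}. \<forall>\<delta>>0. \<exists>u v. a \<le> u \<and> u \<le> t \<and> t \<le> v \<and> v \<le> b \<and> u < v \<and> v - u < \<delta> \<and>
    \<eta> * (v - u) \<le> norm ((v - u) *\<^sub>R f t - integral {u..v} f)}"
  shows "negligible B"
  unfolding negligible_outer_le
proof (intro allI impI)
  fix e :: real assume "e > 0"
  then have "\<eta> * e > 0" using \<open>\<eta> > 0\<close> by simp
  then obtain \<gamma> where \<gamma>: "gauge \<gamma>"
    and small: "\<And>p. \<lbrakk>p tagged_partial_division_of (cbox a b); \<gamma> fine p\<rbrakk> \<Longrightarrow>
             (\<Sum>(x,k)\<in>p. norm (measure lborel k *\<^sub>R f x - integral k f)) < \<eta> * e"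
    using Henstock_lemma[of f a b "\<eta> * e"] f by auto
  \<comment> \<open>An index carries a tag \<open>t\<close> besides the centre \<open>c\<close> and
    the radius \<open>r\<close>: the bad point need not be the midpoint of its interval, and
    Henstock's lemma evaluates \<open>f\<close> at the tag.\<close>
  define K where "K = {(t, c, r). 0 < r \<and> cball c r \<subseteq> {a..b} \<and> t \<in> cball c r \<and> cball c r \<subseteq> \<gamma> t \<and>
    \<eta> * (2 * r) \<le> norm ((2 * r) *\<^sub>R f t - integral (cball c r) f)}"
  define I where "I = (\<lambda>i::real \<times> real \<times> real. cball (fst (snd i)) (snd (snd i)))"
  have "\<exists>i. i \<in> K \<and> x \<in> cball (fst (snd i)) (snd (snd i)) \<and> snd (snd i) < d"
    if "x \<in> B" "0 < d" for x d
  proof -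
    have "open (\<gamma> x)" "x \<in> \<gamma> x" using \<gamma> by (auto simp: gauge_def)
    then obtain \<rho> where "\<rho> > 0" and \<rho>: "ball x \<rho> \<subseteq> \<gamma> x"
      by (meson open_contains_ball)
    have "0 < min \<rho> d" using \<open>\<rho> > 0\<close> that by simp
    then obtain u v where uv: "a \<le> u" "u \<le> x" "x \<le> v" "v \<le> b" "u < v" "v - u < min \<rho> d"
      "\<eta> * (v - u) \<le> norm ((v - u) *\<^sub>R f x - integral {u..v} f)"
      using \<open>x \<in> B\<close> unfolding B_def by blast
    have cb: "cball ((u+v)/2) ((v-u)/2) = {u..v}"
      by (auto simp: dist_real_def cball_def field_simps abs_if split: if_splits)
    have r: "2 * ((v-u)/2) = v - u" by simp
    have sub: "{u..v} \<subseteq> \<gamma> x"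
      using uv \<rho> by (force simp: dist_real_def ball_def)
    have "(x, (u+v)/2, (v-u)/2) \<in> K"
      unfolding K_def mem_Collect_eq case_prod_conv cb r using uv sub by simp
    then show ?thesis
      using uv cb by (intro exI[of _ "(x, (u+v)/2, (v-u)/2)"]) auto
  qed
  note cover = this
  have pos: "\<And>i. i \<in> K \<Longrightarrow> 0 < snd (snd i)"
    by (auto simp: K_def)
  obtain C where C: "countable C" "C \<subseteq> K"
     "pairwise (\<lambda>i j. disjnt (I i) (I j)) C"
     "negligible (B - (\<Union>i \<in> C. I i))"
    unfolding I_def by (rule Vitali_covering_theorem_cballs[OF pos cover])
  have Icb: "I (t, c, r) = cbox (c - r) (c + r)" for t c r
    unfolding I_def by (auto simp: dist_real_def cball_def abs_if)
  \<comment> \<open>Each selected interval contributes at least \<open>\<eta>\<close> times its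
    length to a Henstock sum, and the whole sum is below \<open>\<eta> * e\<close>; dividing by
    \<open>\<eta>\<close> bounds the total length.\<close>
  have fin: "measure lebesgue (\<Union>i\<in>D. I i) \<le> e" if D: "D \<subseteq> C" "finite D" for D
  proof -
    define p where "p = (\<lambda>i. (fst i, I i)) ` D"
    have ne: "I i \<noteq> {}" if "i \<in> C" for i
      using C(2) that by (force simp: I_def K_def)
    have inj: "inj_on (\<lambda>i. (fst i, I i)) D"
      using C(3) D ne unfolding pairwise_def inj_on_def disjnt_def by (metis Int_absorb snd_conv subsetD)
    have "p tagged_partial_division_of (cbox a b)"
      unfolding tagged_partial_division_of_def
    proof (intro conjI allI impI)
      show "finite p" using D by (simp add: p_def)
    next
      fix x k assume "(x, k) \<in> p"
      then obtain i where i: "i \<in> D" "x = fst i" "k = I i" by (auto simp: p_def)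
      with C D have "i \<in> K" by auto
      then show "x \<in> k" "k \<subseteq> cbox a b" "\<exists>a b. k = cbox a b"
        using i Icb[of "fst i" "fst (snd i)" "snd (snd i)"] by (auto simp: K_def I_def)
    next
      fix x k y l assume "(x, k) \<in> p \<and> (y, l) \<in> p \<and> (x, k) \<noteq> (y, l)"
      then obtain i j where ij: "i \<in> D" "k = I i" "j \<in> D" "l = I j" "(fst i, I i) \<noteq> (fst j, I j)"
        unfolding p_def by blast
      then have "i \<noteq> j" by blast
      with C(3) D ij have "disjnt k l" unfolding pairwise_def by blast
      then show "interior k \<inter> interior l = {}"
        unfolding disjnt_def by (metis interior_Int interior_empty)
    qed
    moreover have "\<gamma> fine p"
      using C(2) D by (force simp: fine_def p_def K_def I_def)
    ultimately have *: "(\<Sum>(x,k)\<in>p. norm (measure lborel k *\<^sub>R f x - integral k f)) < \<eta> * e"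
      by (rule small)
    have cont: "measure lebesgue (I i) = 2 * snd (snd i)" "measure lborel (I i) = 2 * snd (snd i)" if "i \<in> C" for i
    proof -
      have "snd (snd i) > 0" using C(2) that by (auto simp: K_def)
      then show "measure lborel (I i) = 2 * snd (snd i)" "measure lebesgue (I i) = 2 * snd (snd i)"
        using Icb[of "fst i" "fst (snd i)" "snd (snd i)"] by auto
    qed
    have "\<eta> * measure lebesgue (\<Union>i\<in>D. I i) \<le> \<eta> * (\<Sum>i\<in>D. measure lebesgue (I i))"
      using \<open>\<eta> > 0\<close> D by (intro mult_left_mono measure_UNION_le) (auto simp: I_def)
    also have "\<dots> = (\<Sum>i\<in>D. \<eta> * (2 * snd (snd i)))"
      unfolding sum_distrib_left using D cont by (intro sum.cong) auto
    also have "\<dots> \<le> (\<Sum>i\<in>D. norm (measure lborel (I i) *\<^sub>R f (fst i) - integral (I i) f))"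
    proof (rule sum_mono)
      fix i assume "i \<in> D"
      with C D have "i \<in> K" "i \<in> C" by auto
      then show "\<eta> * (2 * snd (snd i)) \<le> norm (measure lborel (I i) *\<^sub>R f (fst i) - integral (I i) f)"
        using cont(2) by (auto simp: K_def I_def)
    qed
    also have "\<dots> = (\<Sum>(x,k)\<in>p. norm (measure lborel k *\<^sub>R f x - integral k f))"
      unfolding p_def by (subst sum.reindex[OF inj]) (simp add: o_def)
    finally have "\<eta> * measure lebesgue (\<Union>i\<in>D. I i) \<le> \<eta> * e" using * by simp
    then show ?thesis using \<open>\<eta> > 0\<close> by simp
  qed
  have meas: "\<Union>(I ` C) \<in> lmeasurable \<and> measure lebesgue (\<Union>(I ` C)) \<le> e"
  proof (rule conjI)
    have 1: "\<And>d. d \<in> I ` C \<Longrightarrow> d \<in> lmeasurable" by (auto simp: I_def)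
    have 2: "measure lebesgue (\<Union>D') \<le> e" if "D' \<subseteq> I ` C" "finite D'" for D'
      using fin finite_subset_image[OF that(2,1)] by blast
    show "\<Union>(I ` C) \<in> lmeasurable"
      using fmeasurable_Union_bound[of "I ` C" lebesgue e] 1 2 C(1) by auto
    show "measure lebesgue (\<Union>(I ` C)) \<le> e"
      using measure_Union_bound[of "I ` C" lebesgue e] 1 2 C(1) by auto
  qed
  show "\<exists>T. B \<subseteq> T \<and> T \<in> lmeasurable \<and> measure lebesgue T \<le> e"
  proof (intro exI conjI)
    let ?N = "B - \<Union>(I ` C)"
    show "B \<subseteq> \<Union>(I ` C) \<union> ?N" by auto
    have N: "?N \<in> lmeasurable" "measure lebesgue ?N = 0"
      using C(4) negligible_iff_measure by auto
    then show "\<Union>(I ` C) \<union> ?N \<in> lmeasurable" using meas by blast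
    show "measure lebesgue (\<Union>(I ` C) \<union> ?N) \<le> e"
      using measure_Un_le[of "\<Union>(I ` C)" lebesgue ?N] meas N by (auto simp: fmeasurable_def)
  qed
qed

text \<open>Away from the end points and the null sets belonging to \<eta> = 1/(n+1), the mean
  deviation from \<open>f t\<close> over short intervals containing \<open>t\<close> is below every
  prescribed bound. Difference quotients at \<open>t\<close> are the case in which \<open>t\<close>
  is an end point of the interval.\<close>

theorem AE_has_vector_derivative_indefinite_integral:
  fixes f :: "real \<Rightarrow> 'b::euclidean_space"
  assumes f: "f integrable_on {a..b}"
  shows "AE t in lebesgue_on {a..b}.
    ((\<lambda>s. integral {a..s} f) has_vector_derivative f t) (at t within {a..b})"
proof -
  define B where "B \<eta> = {t \<in> {a<..<b}. \<forall>\<delta>>0. \<exists>u v. a \<le> u \<and> u \<le> t \<and> t \<le> v \<and> v \<le> b \<and> u < v \<and> v - u < \<delta> \<and>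
    \<eta> * (v - u) \<le> norm ((v - u) *\<^sub>R f t - integral {u..v} f)}" for \<eta>
  have neg: "negligible ({a, b} \<union> (\<Union>n. B (1 / real (Suc n))))"
    by (intro negligible_Un negligible_Union_nat negligible_insert[THEN iffD2] negligible_empty
        negligible_nondifferentiability_indefinite_integral[OF f, folded B_def]) auto
  have "((\<lambda>s. integral {a..s} f) has_vector_derivative f t) (at t within {a..b})"
    if t: "t \<in> {a..b}" and nt: "t \<notin> {a, b} \<union> (\<Union>n. B (1 / real (Suc n)))" for t
    unfolding has_vector_derivative_def has_derivative_within_alt
  proof (intro conjI allI impI)
    show "bounded_linear (\<lambda>x. x *\<^sub>R f t)" by (simp add: bounded_linear_scaleR_left)
    fix e :: real assume "e > 0"
    then obtain n where n: "1 / real (Suc n) < e"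
      using nat_approx_posE by metis
    have "t \<notin> B (1 / real (Suc n))" "t \<in> {a<..<b}" using nt t by auto
    then obtain \<delta> where "\<delta> > 0" and \<delta>': "\<nexists>u v. a \<le> u \<and> u \<le> t \<and> t \<le> v \<and> v \<le> b \<and> u < v \<and> v - u < \<delta> \<and>
        1 / real (Suc n) * (v - u) \<le> norm ((v - u) *\<^sub>R f t - integral {u..v} f)"
      unfolding B_def by blast
    have \<delta>: "norm ((v - u) *\<^sub>R f t - integral {u..v} f) < 1 / real (Suc n) * (v - u)"
      if "a \<le> u" "u \<le> t" "t \<le> v" "v \<le> b" "u < v" "v - u < \<delta>" for u v
      using \<delta>' that not_le by blast
    have *: "norm ((v - u) *\<^sub>R f t - integral {u..v} f) \<le> e * (v - u)"
      if "a \<le> u" "u \<le> t" "t \<le> v" "v \<le> b" "u < v" "v - u < \<delta>" for u v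
      using \<delta>[OF that] mult_right_mono[of "1 / real (Suc n)" e "v - u"] n that by linarith
    show "\<exists>d>0. \<forall>y\<in>{a..b}. norm (y - t) < d \<longrightarrow>
      norm (integral {a..y} f - integral {a..t} f - (y - t) *\<^sub>R f t) \<le> e * norm (y - t)"
    proof (intro exI[of _ \<delta>] conjI ballI impI \<open>\<delta> > 0\<close>)
      fix y assume y: "y \<in> {a..b}" "norm (y - t) < \<delta>"
      consider "y = t" | "t < y" | "y < t" by linarith
      then show "norm (integral {a..y} f - integral {a..t} f - (y - t) *\<^sub>R f t) \<le> e * norm (y - t)"
      proof cases
        case 2
        have "integral {a..t} f + integral {t..y} f = integral {a..y} f"
          using t y 2 f by (intro Henstock_Kurzweil_Integration.integral_combine integrable_subinterval_real[OF f]) auto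
        then have "integral {a..y} f - integral {a..t} f - (y - t) *\<^sub>R f t
            = - ((y - t) *\<^sub>R f t - integral {t..y} f)" by (auto simp: algebra_simps)
        then show ?thesis using *[of t y] 2 t y by (simp add: norm_minus_commute)
      next
        case 3
        have "integral {a..y} f + integral {y..t} f = integral {a..t} f"
          using t y 3 f by (intro Henstock_Kurzweil_Integration.integral_combine integrable_subinterval_real[OF f]) auto
        then have "integral {a..y} f - integral {a..t} f - (y - t) *\<^sub>R f t
            = (t - y) *\<^sub>R f t - integral {y..t} f" by (auto simp: algebra_simps)
        then show ?thesis using *[of y t] 3 t y by simp
      qed simp
    qed
  qed
  moreover have "({a, b} \<union> (\<Union>n. B (1 / real (Suc n)))) \<inter> {a..b} \<in> null_sets (lebesgue_on {a..b})"
    using negligible_Int[OF disjI1[OF neg]] by (simp add: null_sets_restrict_space negligible_iff_null_sets)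
  ultimately show ?thesis
    by (intro AE_I') auto
qed

section \<open>Absolute continuity and radial potentials\<close>

text \<open>Truncation: |f| is at most \<open>g N\<close> + N, where the excess \<open>g N\<close>
  of |f| over N has an integral tending to 0. N is fixed so that the excess costs less than e/2 over
  the whole interval, and \<open>\<delta>\<close> is then small enough for the constant N to cost at
  most e/2.\<close>

lemma abs_continuous_on_indefinite_integral:
  fixes f :: "real \<Rightarrow> 'b::euclidean_space"
  assumes f: "f absolutely_integrable_on {a..b}"
    and x: "\<And>t. t \<in> {a..b} \<Longrightarrow> x t = c + integral {a..t} f"
  shows "abs_continuous_on {a..b} x"
  unfolding abs_continuous_on_def
proof (intro allI impI)
  fix e :: real assume "e > 0"
  define h where "h t = norm (f t)" for t
  define g where "g N t = max 0 (h t - real N)" for N t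
  have fi: "f integrable_on {a..b}" and hi: "h integrable_on {a..b}"
    using f by (auto simp: absolutely_integrable_on_def h_def[abs_def])
  have hm: "h \<in> borel_measurable (lebesgue_on {a..b})"
    using integrable_imp_measurable[OF hi] .
  have gi: "g N integrable_on {a..b}" for N
  proof (rule measurable_bounded_by_integrable_imp_integrable[OF _ hi])
    show "g N \<in> borel_measurable (lebesgue_on {a..b})"
      unfolding g_def[abs_def] by (intro borel_measurable_max borel_measurable_diff hm borel_measurable_const)
  qed (auto simp: g_def h_def)
  have "(\<lambda>N. integral {a..b} (g N)) \<longlonglongrightarrow> integral {a..b} (\<lambda>t. 0)"
  proof (rule dominated_convergence(2)[OF gi hi])
    show "(\<lambda>N. g N t) \<longlonglongrightarrow> 0" for t
    proof (rule tendsto_eventually, rule eventually_sequentiallyI)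
      fix N assume "nat \<lceil>h t\<rceil> \<le> N"
      then show "g N t = 0" unfolding g_def by linarith
    qed
  qed (auto simp: g_def h_def)
  then have "\<forall>\<^sub>F N in sequentially. integral {a..b} (g N) < e / 2"
    using \<open>e > 0\<close> by (intro order_tendstoD) auto
  then obtain N where N: "integral {a..b} (g N) < e / 2"
    by (auto simp: eventually_sequentially)
  define \<delta> where "\<delta> = e / (2 * (real N + 1))"
  have "\<delta> > 0" using \<open>e > 0\<close> by (simp add: \<delta>_def)
  show "\<exists>\<delta>>0. \<forall>D S. D division_of S \<and> S \<subseteq> {a..b} \<and> (\<Sum>K\<in>D. measure lborel K) < \<delta> \<longrightarrow>
      (\<Sum>K\<in>D. norm (x (Sup K) - x (Inf K))) < e"
  proof (intro exI[of _ \<delta>] conjI allI impI \<open>\<delta> > 0\<close>, elim conjE)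
    fix D S assume D: "D division_of S" and S: "S \<subseteq> {a..b}" and small: "(\<Sum>K\<in>D. measure lborel K) < \<delta>"
    have "norm (x (Sup K) - x (Inf K)) \<le> integral K (g N) + real N * measure lborel K" if KD: "K \<in> D" for K
    proof -
      obtain u v where K: "K = {u..v}" and "u \<le> v"
        using division_ofD(3,4)[OF D KD] by (metis atLeastatMost_empty_iff box_real(2))
      have sub: "{u..v} \<subseteq> {a..b}" using division_ofD(2)[OF D KD] S unfolding K by (rule subset_trans)
      then have uv: "a \<le> u" "v \<le> b" using \<open>u \<le> v\<close> by auto
      have "integral {a..u} f + integral {u..v} f = integral {a..v} f"
        using uv \<open>u \<le> v\<close>
        by (intro Henstock_Kurzweil_Integration.integral_combine integrable_subinterval_real[OF fi]) auto
      then have "x (Sup K) - x (Inf K) = integral {u..v} f"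
        using x[of u] x[of v] uv \<open>u \<le> v\<close> K by (simp add: algebra_simps)
      moreover have "norm (integral {u..v} f) \<le> integral {u..v} (\<lambda>t. g N t + real N)"
        using sub by (intro Henstock_Kurzweil_Integration.integral_norm_bound_integral integrable_add
            integrable_subinterval_real[OF fi] integrable_subinterval_real[OF gi])
          (auto simp: g_def h_def)
      moreover have "integral {u..v} (\<lambda>t. g N t + real N) = integral {u..v} (g N) + real N * (v - u)"
        using sub \<open>u \<le> v\<close> by (subst Henstock_Kurzweil_Integration.integral_add)
          (auto intro: integrable_subinterval_real[OF gi])
      ultimately show ?thesis using K \<open>u \<le> v\<close> by simp
    qed
    then have "(\<Sum>K\<in>D. norm (x (Sup K) - x (Inf K))) \<le> (\<Sum>K\<in>D. integral K (g N) + real N * measure lborel K)"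
      by (rule sum_mono)
    also have "\<dots> = (\<Sum>K\<in>D. integral K (g N)) + real N * (\<Sum>K\<in>D. measure lborel K)"
      by (simp add: sum.distrib sum_distrib_left)
    also have "(\<Sum>K\<in>D. integral K (g N)) \<le> integral {a..b} (g N)"
    proof (rule has_integral_subset_le[OF S])
      show "(g N has_integral (\<Sum>K\<in>D. integral K (g N))) S"
        by (rule has_integral_combine_division_topdown[OF gi D S])
      show "(g N has_integral integral {a..b} (g N)) {a..b}"
        using gi by (rule integrable_integral)
    qed (simp add: g_def)
    also have "real N * (\<Sum>K\<in>D. measure lborel K) \<le> real N * \<delta>"
      using small by (intro mult_left_mono) auto
    also have "real N * \<delta> \<le> e / 2"
      using \<open>e > 0\<close> by (simp add: \<delta>_def field_simps)
    finally show "(\<Sum>K\<in>D. norm (x (Sup K) - x (Inf K))) < e" using N by linarith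
  qed
qed

text \<open>A short step in a direction \<open>v\<close> with \<open>v \<bullet> x < 0\<close> does
  not increase the norm, hence does not increase \<open>V\<close>. So the open half-space
  \<open>v \<bullet> x < 0\<close> is contained in \<open>v \<bullet> d \<le> 0\<close>, which
  forces \<open>d\<close> to be a nonnegative multiple of \<open>x\<close>.\<close>

lemma gradient_radial:
  fixes V :: "real^'n \<Rightarrow> real"
  assumes mono: "monotone_potential V" and diff: "V differentiable at x" and "x \<noteq> 0"
  obtains c where "c \<ge> 0" "gradient V x = c *\<^sub>R x"
proof -
  obtain D where D: "(V has_derivative D) (at x)" using diff by (auto simp: differentiable_def)
  interpret D: bounded_linear D using D by (rule has_derivative_bounded_linear)
  define d where "d = (\<Sum>b\<in>Basis. D b *\<^sub>R b)"
  have Dd: "D h = h \<bullet> d" for h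
  proof -
    have "D h = D (\<Sum>b\<in>Basis. (h \<bullet> b) *\<^sub>R b)" by (simp add: euclidean_representation)
    also have "\<dots> = h \<bullet> d"
      by (simp add: D.sum D.scaleR d_def inner_sum_right mult.commute)
    finally show ?thesis .
  qed
  then have "GDERIV V x :> d"
    using D ext[of D "\<lambda>h. h \<bullet> d"] unfolding gderiv_def by auto
  then have grad: "gradient V x = d" by (rule gradient_eqI)
  have descent: "v \<bullet> d \<le> 0" if v: "v \<bullet> x < 0" for v
  proof (rule ccontr)
    assume "\<not> v \<bullet> d \<le> 0"
    have "((\<lambda>h. V (x + h *\<^sub>R v)) has_derivative (\<lambda>h. D (h *\<^sub>R v))) (at 0)"
      by (rule has_derivative_compose[where g = V and f = "\<lambda>h. x + h *\<^sub>R v", unfolded o_def])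
         (auto intro!: derivative_eq_intros D)
    then have "((\<lambda>h. V (x + h *\<^sub>R v)) has_field_derivative (v \<bullet> d)) (at 0)"
      unfolding has_field_derivative_def by (simp add: Dd[abs_def] mult.commute[of _ "v \<bullet> d"])
    then obtain s where s: "s > 0" "\<And>h. 0 < h \<Longrightarrow> h < s \<Longrightarrow> V (x + 0 *\<^sub>R v) < V (x + (0 + h) *\<^sub>R v)"
      using has_real_derivative_pos_inc_right[of "\<lambda>h. V (x + h *\<^sub>R v)" "v \<bullet> d" 0 UNIV] \<open>\<not> v \<bullet> d \<le> 0\<close>
      by auto
    have "v \<noteq> 0" using v by auto
    \<comment> \<open>The second bound makes the change
      \<open>h * (2 * (v \<bullet> x) + h * (v \<bullet> v))\<close> of the squared norm at most
      \<open>h * (v \<bullet> x) < 0\<close>, while \<open>h < s\<close> lets the positive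
      derivative increase \<open>V\<close> strictly: a contradiction to monotonicity.\<close>
    define h where "h = min (s / 2) (- (v \<bullet> x) / (v \<bullet> v))"
    have h: "0 < h" "h < s" "h * (v \<bullet> v) \<le> - (v \<bullet> x)"
      using s v \<open>v \<noteq> 0\<close> by (auto simp: h_def min_def field_simps)
    have "(x + h *\<^sub>R v) \<bullet> (x + h *\<^sub>R v) = x \<bullet> x + h * (2 * (v \<bullet> x) + h * (v \<bullet> v))"
      by (simp add: inner_simps inner_commute algebra_simps)
    also have "\<dots> \<le> x \<bullet> x"
      using h v by (auto simp: mult_le_0_iff)
    finally have "norm (x + h *\<^sub>R v) \<le> norm x" by (simp add: norm_le)
    then have "V (x + h *\<^sub>R v) \<le> V x" using mono by (simp add: monotone_potential_def)
    then show False using s(2)[OF h(1,2)] by simp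
  qed
  define c where "c = (d \<bullet> x) / (x \<bullet> x)"
  define w where "w = d - c *\<^sub>R x"
  have wx: "w \<bullet> x = 0" using \<open>x \<noteq> 0\<close> by (simp add: w_def c_def inner_simps)
  \<comment> \<open>The part \<open>w\<close> of \<open>d\<close> orthogonal to \<open>x\<close>
    lies only on the boundary of the half-space in \<open>descent\<close>, so it is tilted to
    \<open>w - k *\<^sub>R x\<close> and \<open>k\<close> is made small. The result kills
    \<open>w\<close>, because \<open>w \<bullet> d = w \<bullet> w\<close>.\<close>
  have "w \<bullet> d \<le> 0"
  proof (rule field_le_epsilon)
    fix e :: real assume "e > 0"
    define k where "k = e / (1 + \<bar>x \<bullet> d\<bar>)"
    have "k > 0" using \<open>e > 0\<close> by (simp add: k_def)
    then have "(w - k *\<^sub>R x) \<bullet> d \<le> 0"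
      using wx \<open>x \<noteq> 0\<close> by (intro descent) (auto simp: inner_simps)
    moreover have "k * (x \<bullet> d) \<le> e"
    proof -
      have "k * (x \<bullet> d) \<le> k * (1 + \<bar>x \<bullet> d\<bar>)" using \<open>k > 0\<close> by (intro mult_left_mono) auto
      then show ?thesis by (simp add: k_def)
    qed
    ultimately show "w \<bullet> d \<le> 0 + e" by (simp add: inner_simps)
  qed
  moreover have "w \<bullet> d = w \<bullet> w" using wx by (simp add: w_def inner_simps inner_commute)
  ultimately have "w = 0" by (metis inner_ge_zero inner_eq_zero_iff order_antisym)
  then have d: "d = c *\<^sub>R x" by (simp add: w_def)
  have "(- x) \<bullet> d \<le> 0" using \<open>x \<noteq> 0\<close> by (intro descent) auto
  then have "0 \<le> x \<bullet> d" by simp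
  then have "c \<ge> 0" unfolding c_def by (simp add: inner_commute)
  then show ?thesis using that d grad by simp
qed

text \<open>Nonsingularity turns the factor \<open>c \<ge> 0\<close> into \<open>c > 0\<close>, so
  that it can be cancelled from the guiding inequality. The two properties come with independent
  radii, hence the maximum.\<close>

lemma guiding_inner_le_0:
  fixes F :: "real \<Rightarrow> real^'n \<Rightarrow> (real^'n) set"
  assumes mono: "monotone_potential V" and guide: "weakly_negatively_guiding I F V"
  obtains R where "R > 0" "\<And>x t. norm x \<ge> R \<Longrightarrow> t \<in> I \<Longrightarrow> \<exists>y\<in>F t x. x \<bullet> y \<le> 0"
proof -
  from guide obtain R1 R2 where R: "R1 > 0" "\<And>x. norm x \<ge> R1 \<Longrightarrow> gradient V x \<noteq> 0"
    "\<And>x t. norm x \<ge> R2 \<Longrightarrow> t \<in> I \<Longrightarrow> \<exists>y\<in>F t x. gradient V x \<bullet> y \<le> 0"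
    and diff: "\<And>x. V differentiable at x"
    unfolding weakly_negatively_guiding_def nonsingular_def C1_def by metis
  show ?thesis
  proof (rule that[of "max R1 R2"])
    fix x :: "real^'n" and t assume x: "max R1 R2 \<le> norm x" and t: "t \<in> I"
    then have "x \<noteq> 0" using R(1) by auto
    then obtain c where c: "c \<ge> 0" "gradient V x = c *\<^sub>R x"
      using gradient_radial[OF mono diff] by metis
    have "gradient V x \<noteq> 0" using R x by auto
    then have "c > 0" using c by (cases "c = 0") auto
    obtain y where "y \<in> F t x" "gradient V x \<bullet> y \<le> 0" using R x t by fastforce
    then show "\<exists>y\<in>F t x. x \<bullet> y \<le> 0"
      using c \<open>c > 0\<close> by (auto simp: mult_le_0_iff)
  qed (use R in auto)
qed

section \<open>Almost everywhere convergent midpoint combinations\<close>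

text \<open>Up to presentation these are the finite convex combinations with dyadic weights, the
  same weights at every point \<open>t\<close>. Midpoints are all that the parallelogram law
  compares, and they make every closure property a two-case induction.\<close>

inductive_set midpoint_hull :: "('a \<Rightarrow> 'b::real_vector) set \<Rightarrow> ('a \<Rightarrow> 'b) set" for A where
  base: "f \<in> A \<Longrightarrow> f \<in> midpoint_hull A"
| midpoint: "f \<in> midpoint_hull A \<Longrightarrow> g \<in> midpoint_hull A \<Longrightarrow>
    (\<lambda>t. (1/2) *\<^sub>R (f t + g t)) \<in> midpoint_hull A"

lemma midpoint_hull_mono:
  assumes "A \<subseteq> B"
  shows "midpoint_hull A \<subseteq> midpoint_hull B"
proof
  fix f assume "f \<in> midpoint_hull A"
  then show "f \<in> midpoint_hull B"
    by induction (use assms in \<open>auto intro: midpoint_hull.intros\<close>)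
qed

lemma midpoint_hull_in_convex:
  assumes "g \<in> midpoint_hull A" "\<And>f. f \<in> A \<Longrightarrow> f t \<in> S" "convex S"
  shows "g t \<in> S"
  using assms(1)
proof induction
  case (midpoint f g)
  then show ?case
    using convexD[OF \<open>convex S\<close>, of "f t" "g t" "1/2" "1/2"] by (simp add: scaleR_add_right)
qed (use assms in auto)

lemma midpoint_hull_measurable:
  fixes A :: "('a \<Rightarrow> 'b::euclidean_space) set"
  assumes "g \<in> midpoint_hull A" "\<And>f. f \<in> A \<Longrightarrow> f \<in> borel_measurable M"
  shows "g \<in> borel_measurable M"
  using assms(1) by induction (use assms(2) in auto)

lemma parallelogram_midpoint:
  fixes a b :: "'b::real_inner"
  shows "(norm (a - b))\<^sup>2 = 2 * (norm a)\<^sup>2 + 2 * (norm b)\<^sup>2 - 4 * (norm ((1/2) *\<^sub>R (a + b)))\<^sup>2"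
  by (simp add: power_divide power2_norm_eq_inner inner_simps inner_commute field_simps)

text \<open>A substitute for the weak compactness of order intervals in \<open>L\<^sup>1\<close>: the functional
  \<open>\<integral> |g|\<^sup>2 / m\<close> is uniformly convex, so elements of the hulls of the tails that nearly minimise
  it form a Cauchy sequence.\<close>

lemma midpoint_hull_tails_AE_convergent:
  fixes f :: "nat \<Rightarrow> 'a \<Rightarrow> 'b::euclidean_space"
  assumes meas: "\<And>k. f k \<in> borel_measurable M"
    and bound: "\<And>k t. t \<in> space M \<Longrightarrow> norm (f k t) \<le> m t"
    and m: "integrable M m" and m_pos: "\<And>t. t \<in> space M \<Longrightarrow> m t > 0"
  shows "\<exists>g y. (\<forall>k. g k \<in> midpoint_hull (f ` {k..})) \<and> (AE t in M. (\<lambda>k. g k t) \<longlonglongrightarrow> y t)"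
proof -
  define H where "H k = midpoint_hull (f ` {k..})" for k
  \<comment> \<open>The weight 1/m keeps the functional finite: \<open>m\<close> is only integrable,
    so |g|^2 need not be, but |g| \<le> m gives |g|^2/m \<le> m.\<close>
  define Q where "Q g = (\<integral>t. (norm (g t))\<^sup>2 / m t \<partial>M)" for g :: "'a \<Rightarrow> 'b"
  have m_meas [measurable]: "m \<in> borel_measurable M" using m by auto
  have H_meas: "g \<in> borel_measurable M" if "g \<in> H k" for g k
    using midpoint_hull_measurable that meas unfolding H_def by blast
  have H_bound: "norm (g t) \<le> m t" if "g \<in> H k" "t \<in> space M" for g k t
    using midpoint_hull_in_convex[of g "f ` {k..}" t "cball 0 (m t)"] that bound
    unfolding H_def by (auto simp: dist_norm)
  have H_anti: "H l \<subseteq> H k" if "k \<le> l" for k l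
    unfolding H_def using that by (intro midpoint_hull_mono) auto
  \<comment> \<open>The bound \<open>2 * m\<close> in place of \<open>m\<close> admits differences
    of two hull elements.\<close>
  have Q_int: "integrable M (\<lambda>t. (norm (g t))\<^sup>2 / m t)"
    if g: "g \<in> borel_measurable M" "\<And>t. t \<in> space M \<Longrightarrow> norm (g t) \<le> 2 * m t" for g :: "'a \<Rightarrow> 'b"
  proof (rule Bochner_Integration.integrable_bound[of M "\<lambda>t. 4 * m t"])
    show "AE t in M. norm ((norm (g t))\<^sup>2 / m t) \<le> norm (4 * m t)"
    proof (rule AE_I2)
      fix t assume t: "t \<in> space M"
      have "(norm (g t))\<^sup>2 \<le> (2 * m t)\<^sup>2" using g(2)[OF t] by (intro power_mono) auto
      then show "norm ((norm (g t))\<^sup>2 / m t) \<le> norm (4 * m t)"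
        using m_pos[OF t] by (auto simp: field_simps power2_eq_square)
    qed
  qed (use g m in auto)
  have H_Q_int: "integrable M (\<lambda>t. (norm (g t))\<^sup>2 / m t)" if "g \<in> H k" for g k
  proof (rule Q_int[OF H_meas[OF that]])
    show "norm (g t) \<le> 2 * m t" if "t \<in> space M" for t
      using H_bound[OF \<open>g \<in> H k\<close> that] m_pos[OF that] by linarith
  qed
  have Q_nonneg: "0 \<le> Q g" for g
    unfolding Q_def using m_pos by (intro integral_nonneg_AE AE_I2) (auto simp: less_imp_le)
  define d where "d k = Inf (Q ` H k)" for k
  have H_ne: "f k \<in> H k" for k unfolding H_def by (auto intro: midpoint_hull.base)
  have bdd: "bdd_below (Q ` S)" for S using Q_nonneg by (intro bdd_belowI[of _ 0]) auto
  have d_le: "d k \<le> Q g" if "g \<in> H k" for g k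
    unfolding d_def using that by (intro cInf_lower bdd) auto
  have d_mono: "d k \<le> d l" if "k \<le> l" for k l
    unfolding d_def using H_anti[OF that] H_ne[of l] by (intro cInf_superset_mono bdd) auto
  have "d k \<le> (\<integral>t. m t \<partial>M)" for k
  proof -
    have "d k \<le> Q (f k)" using H_ne by (rule d_le)
    also have "\<dots> \<le> (\<integral>t. m t \<partial>M)"
      unfolding Q_def
    proof (rule integral_mono[OF H_Q_int[OF H_ne] m])
      fix t assume t: "t \<in> space M"
      have "(norm (f k t))\<^sup>2 \<le> (m t)\<^sup>2" using bound[OF t] by (intro power_mono) auto
      then show "(norm (f k t))\<^sup>2 / m t \<le> m t"
        using m_pos[OF t] by (auto simp: field_simps power2_eq_square)
    qed
    finally show ?thesis .
  qed
  then obtain D where D: "d \<longlonglongrightarrow> D" "\<And>k. d k \<le> D"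
    using incseq_convergent[of d] d_mono by (auto simp: incseq_def)
  \<comment> \<open>The element nearly minimises \<open>Q\<close>, and the infimum over its tail is
    already close to the limit \<open>D\<close>, which will bound midpoints from below. The rate 1/4
    is chosen because integral norms of differences behave like square roots of \<open>Q\<close>,
    leaving the summable rate 1/2.\<close>
  have "\<exists>g n. k \<le> n \<and> g \<in> H n \<and> D - (1/4)^k < d n \<and> Q g < D + (1/4)^k" for k
  proof -
    have "\<forall>\<^sub>F n in sequentially. D - (1/4)^k < d n"
      using D(1) by (intro order_tendstoD) auto
    then obtain n0 where n0: "\<And>n. n \<ge> n0 \<Longrightarrow> D - (1/4)^k < d n"
      by (auto simp: eventually_sequentially)
    define n where "n = max k n0"
    have "Inf (Q ` H n) < D + (1/4)^k"
      using D(2)[of n] zero_less_power[of "1/4::real" k] unfolding d_def by linarith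
    then obtain g where "g \<in> H n" "Q g < D + (1/4)^k"
      using H_ne[of n] by (subst (asm) cInf_less_iff[OF _ bdd]) auto
    moreover have "k \<le> n" "D - (1/4)^k < d n" using n0[of n] by (auto simp: n_def)
    ultimately show ?thesis by blast
  qed
  then obtain g n where gn: "\<And>k. k \<le> n k" "\<And>k. g k \<in> H (n k)" "\<And>k. D - (1/4)^k < d (n k)"
    "\<And>k. Q (g k) < D + (1/4)^k" by metis
  have g_meas [measurable]: "g k \<in> borel_measurable M" for k using H_meas gn(2) by blast
  \<comment> \<open>With \<epsilon> = (1/4)^k, the midpoint of two successive elements lies in the
    larger of their two hulls, so its \<open>Q\<close> exceeds D - \<epsilon>. The parallelogram law
    then gives 2(D + \<epsilon>) + 2(D + \<epsilon>) - 4(D - \<epsilon>) = 8\<epsilon>.\<close>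
  have cauchy: "Q (\<lambda>t. g (Suc k) t - g k t) \<le> 8 * (1/4)^k" for k
  proof -
    define h where "h t = (1/2) *\<^sub>R (g (Suc k) t + g k t)" for t
    define p where "p = min (n k) (n (Suc k))"
    have "g k \<in> H p" "g (Suc k) \<in> H p"
      using gn(2) H_anti[of p] unfolding p_def by (meson min.cobounded1 min.cobounded2 subsetD)+
    then have h: "h \<in> H p" unfolding H_def h_def[abs_def] by (intro midpoint_hull.midpoint)
    have e: "(1/4::real) ^ Suc k \<le> (1/4) ^ k" by (simp add: power_decreasing)
    have "D - (1/4)^k < d (n (Suc k))" using gn(3)[of "Suc k"] e by linarith
    then have "D - (1/4)^k < d p"
      using gn(3)[of k] by (simp add: p_def min_def)
    then have "D - (1/4)^k < Q h" using d_le[OF h] by linarith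
    moreover have "Q (\<lambda>t. g (Suc k) t - g k t) = 2 * Q (g (Suc k)) + 2 * Q (g k) - 4 * Q h"
    proof -
      have "(norm (g (Suc k) t - g k t))\<^sup>2 / m t
        = 2 * ((norm (g (Suc k) t))\<^sup>2 / m t) + 2 * ((norm (g k t))\<^sup>2 / m t) - 4 * ((norm (h t))\<^sup>2 / m t)" for t
        unfolding h_def parallelogram_midpoint by (simp add: add_divide_distrib diff_divide_distrib)
      then show ?thesis
        unfolding Q_def using H_Q_int[OF gn(2)] H_Q_int[OF h] by (simp del: times_divide_eq_right)
    qed
    moreover have "Q (g (Suc k)) < D + (1/4)^k" using gn(4)[of "Suc k"] e by linarith
    moreover have "Q (g k) < D + (1/4)^k" by (rule gn(4))
    ultimately show ?thesis by linarith
  qed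
  define C where "C = (\<integral>t. m t \<partial>M) / 2 + 4"
  have diff_le: "norm (g (Suc k) t - g k t) \<le> 2 * m t" if "t \<in> space M" for k t
    using norm_triangle_ineq4[of "g (Suc k) t" "g k t"] H_bound[OF gn(2) that, of k] H_bound[OF gn(2) that, of "Suc k"] by linarith
  have diff_int: "integrable M (\<lambda>t. norm (g (Suc k) t - g k t))" for k
    by (rule Bochner_Integration.integrable_bound[of M "\<lambda>t. 2 * m t"])
       (use m diff_le m_pos in \<open>auto simp: less_imp_le abs_mult\<close>)
  \<comment> \<open>Young's inequality a \<le> (em + a^2/(em))/2 with e = (1/2)^k makes both terms
    of order (1/2)^k. In \<open>C\<close> the first term accounts for half the integral of
    \<open>m\<close>, the second for 8/2 = 4.\<close>
  have L1: "(\<integral>t. norm (g (Suc k) t - g k t) \<partial>M) \<le> C * (1/2)^k" for k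
  proof -
    have "(\<integral>t. norm (g (Suc k) t - g k t) \<partial>M)
      \<le> (\<integral>t. (1/2)^k / 2 * m t + 2^k / 2 * ((norm (g (Suc k) t - g k t))\<^sup>2 / m t) \<partial>M)"
    proof (rule integral_mono[OF diff_int])
      show "integrable M (\<lambda>t. (1/2)^k / 2 * m t + 2^k / 2 * ((norm (g (Suc k) t - g k t))\<^sup>2 / m t))"
        using m diff_le by (intro Bochner_Integration.integrable_add integrable_mult_right Q_int) auto
      fix t assume t: "t \<in> space M"
      let ?a = "norm (g (Suc k) t - g k t)"
      have "0 \<le> ((1/2)^k * m t - ?a)\<^sup>2" by simp
      then have "?a * (2 * (1/2)^k * m t) \<le> ((1/2)^k * m t)\<^sup>2 + ?a\<^sup>2"
        by (simp add: power2_diff algebra_simps)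
      then have "?a \<le> (((1/2)^k * m t)\<^sup>2 + ?a\<^sup>2) / (2 * (1/2)^k * m t)"
        using m_pos[OF t] by (simp add: pos_le_divide_eq)
      also have "\<dots> = (1/2)^k / 2 * m t + 2^k / 2 * (?a\<^sup>2 / m t)"
        using m_pos[OF t] by (simp add: field_simps power2_eq_square)
      finally show "?a \<le> (1/2)^k / 2 * m t + 2^k / 2 * (?a\<^sup>2 / m t)" .
    qed
    also have "\<dots> = (1/2)^k / 2 * (\<integral>t. m t \<partial>M) + 2^k / 2 * Q (\<lambda>t. g (Suc k) t - g k t)"
      unfolding Q_def using m diff_le
      by (subst Bochner_Integration.integral_add)
        (auto intro!: Q_int integrable_mult_right simp del: times_divide_eq_right times_divide_eq_left times_divide_times_eq)
    also have "\<dots> \<le> (1/2)^k / 2 * (\<integral>t. m t \<partial>M) + 2^k / 2 * (8 * (1/4)^k)"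
      using cauchy by (intro add_left_mono mult_left_mono) auto
    also have "\<dots> = C * (1/2)^k"
    proof -
      have "(2::real)^k * (1/4)^k = (1/2)^k" by (simp flip: power_mult_distrib)
      then show ?thesis unfolding C_def by (simp add: algebra_simps)
    qed
    finally show ?thesis .
  qed
  have "(\<integral>\<^sup>+t. (\<Sum>k. ennreal (norm (g (Suc k) t - g k t))) \<partial>M) = (\<Sum>k. \<integral>\<^sup>+t. ennreal (norm (g (Suc k) t - g k t)) \<partial>M)"
    by (rule nn_integral_suminf) auto
  also have "\<dots> = (\<Sum>k. ennreal (\<integral>t. norm (g (Suc k) t - g k t) \<partial>M))"
    by (subst nn_integral_eq_integral[OF diff_int]) auto
  also have "\<dots> \<noteq> \<infinity>"
  proof -
    have "summable (\<lambda>k. \<integral>t. norm (g (Suc k) t - g k t) \<partial>M)"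
      by (rule summable_comparison_test'[of "\<lambda>k. C * (1/2)^k" 0])
         (use L1 in \<open>auto intro!: summable_mult summable_geometric\<close>)
    then show ?thesis
      by (subst suminf_ennreal2) auto
  qed
  finally have "AE t in M. (\<Sum>k. ennreal (norm (g (Suc k) t - g k t))) \<noteq> \<infinity>"
    by (intro nn_integral_PInf_AE) auto
  then have conv: "AE t in M. (\<lambda>k. g k t) \<longlonglongrightarrow> lim (\<lambda>k. g k t)"
  proof eventually_elim
    case (elim t)
    then have "summable (\<lambda>k. norm (g (Suc k) t - g k t))"
      by (intro summable_suminf_not_top) auto
    then have "summable (\<lambda>k. g (Suc k) t - g k t)" by (rule summable_norm_cancel)
    then have "(\<lambda>n. g n t - g 0 t) \<longlonglongrightarrow> (\<Sum>k. g (Suc k) t - g k t)"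
      using summable_LIMSEQ sum_lessThan_telescope[of "\<lambda>k. g k t"] by (metis (no_types, lifting) ext)
    from tendsto_add[OF this tendsto_const[of "g 0 t"]]
    have "convergent (\<lambda>k. g k t)" by (auto simp: convergent_def)
    then show ?case by (simp add: convergent_LIMSEQ_iff)
  qed
  have "g k \<in> midpoint_hull (f ` {k..})" for k
    using gn(1,2) H_anti[of k "n k"] by (auto simp: H_def)
  with conv show ?thesis
    by (intro exI[of _ g] exI[of _ "\<lambda>t. lim (\<lambda>k. g k t)"] conjI allI)
qed

section \<open>Measurable and approximately continuous selections\<close>

text \<open>A compact \<open>G t\<close> missing the closed set \<open>C\<close> keeps a positive
  distance from it. Missing \<open>C\<close> is therefore a countable union of inclusions
  \<open>G t \<subseteq> A n\<close>, with \<open>A n\<close> the closed set of points at distance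
  at least 1/(n+1) from every point of \<open>C\<close>.\<close>

lemma measurable_hits_closed:
  fixes G :: "real \<Rightarrow> ('b::euclidean_space) set"
  assumes meas: "\<And>A. closed A \<Longrightarrow> {t\<in>I. G t \<subseteq> A} \<in> sets lebesgue"
    and comp: "\<And>t. t \<in> I \<Longrightarrow> compact (G t)" and C: "closed C"
  shows "{t\<in>I. G t \<inter> C \<noteq> {}} \<in> sets lebesgue"
proof -
  define A where "A n = (\<Inter>y\<in>C. {x. 1 / real (Suc n) \<le> dist x y})" for n
  have clA: "closed (A n)" for n
    unfolding A_def by (intro closed_INT ballI closed_Collect_le continuous_intros)
  have "{t\<in>I. G t \<inter> C \<noteq> {}} = {t\<in>I. G t \<subseteq> UNIV} - (\<Union>n. {t\<in>I. G t \<subseteq> A n})"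
  proof (intro set_eqI iffI)
    fix t assume t: "t \<in> {t\<in>I. G t \<inter> C \<noteq> {}}"
    then obtain y where y: "y \<in> G t" "y \<in> C" by auto
    have "y \<notin> A n" for n
    proof
      assume "y \<in> A n"
      then have "1 / real (Suc n) \<le> dist y y" using y unfolding A_def by blast
      then show False by (simp add: field_simps)
    qed
    with t y show "t \<in> {t\<in>I. G t \<subseteq> UNIV} - (\<Union>n. {t\<in>I. G t \<subseteq> A n})" by auto
  next
    fix t assume t: "t \<in> {t\<in>I. G t \<subseteq> UNIV} - (\<Union>n. {t\<in>I. G t \<subseteq> A n})"
    have "G t \<inter> C \<noteq> {}"
    proof
      assume "G t \<inter> C = {}"
      then obtain e where e: "e > 0" "\<And>x y. x \<in> G t \<Longrightarrow> y \<in> C \<Longrightarrow> e \<le> dist x y"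
        using separate_compact_closed[of "G t" C] comp C t by auto
      then obtain n where n: "1 / real (Suc n) < e" using nat_approx_posE by metis
      have "1 / real (Suc n) \<le> dist x y" if "x \<in> G t" "y \<in> C" for x y
        using e(2)[OF that] n by linarith
      then have "G t \<subseteq> A n" unfolding A_def by blast
      with t show False by auto
    qed
    with t show "t \<in> {t\<in>I. G t \<inter> C \<noteq> {}}" by auto
  qed
  also have "\<dots> \<in> sets lebesgue"
    by (intro sets.Diff sets.countable_UN meas clA image_subsetI) auto
  finally show ?thesis .
qed

text \<open>The selection is the point of least norm of \<open>G t \<inter> H\<close>, unique by
  convexity. Its norm and its membership in a closed set can both be expressed by countably many
  conditions that \<open>G t\<close> meets a closed set. \<open>H\<close> serves to impose the
  inward half-space on the selection.\<close>

lemma measurable_selection_min_norm: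
  fixes G :: "real \<Rightarrow> ('b::euclidean_space) set"
  assumes meas: "\<And>A. closed A \<Longrightarrow> {t\<in>I. G t \<subseteq> A} \<in> sets lebesgue"
    and comp: "\<And>t. t \<in> I \<Longrightarrow> compact (G t)" and conv: "\<And>t. t \<in> I \<Longrightarrow> convex (G t)"
    and H: "closed H" "convex H" and ne: "\<And>t. t \<in> I \<Longrightarrow> G t \<inter> H \<noteq> {}"
  obtains g where "g \<in> borel_measurable (lebesgue_on I)" "\<And>t. t \<in> I \<Longrightarrow> g t \<in> G t \<inter> H"
proof -
  have "{t\<in>I. G t \<subseteq> UNIV} \<in> sets lebesgue" by (rule meas) auto
  then have I: "I \<in> sets lebesgue" by simp
  have sets: "S \<in> sets (lebesgue_on I) \<longleftrightarrow> S \<subseteq> I \<and> S \<in> sets lebesgue" for S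
    using I by (simp add: sets_restrict_space_iff)
  have hits: "{t\<in>I. G t \<inter> C \<noteq> {}} \<in> sets (lebesgue_on I)" if "closed C" for C
    unfolding sets using measurable_hits_closed[OF meas comp that] by auto
  define g where "g t = closest_point (G t \<inter> H) 0" for t
  have cl: "closed (G t \<inter> H)" if "t \<in> I" for t
    using comp[OF that] H by (auto intro: compact_imp_closed)
  have g: "g t \<in> G t \<inter> H" if "t \<in> I" for t
    unfolding g_def by (rule closest_point_in_set[OF cl ne]) (use that in auto)
  have g_le: "norm (g t) \<le> norm y" if "t \<in> I" "y \<in> G t \<inter> H" for t y
    using closest_point_le[OF cl[OF that(1)] that(2), of 0] by (simp add: g_def)
  have g_unique: "y = g t" if "t \<in> I" "y \<in> G t \<inter> H" "norm y \<le> norm (g t)" for t y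
    unfolding g_def
  proof (rule closest_point_unique[OF _ cl that(2)])
    show "convex (G t \<inter> H)" using conv H that by (auto intro: convex_Int)
    show "\<forall>z\<in>G t \<inter> H. dist 0 y \<le> dist 0 z"
    proof
      fix z assume "z \<in> G t \<inter> H"
      from order_trans[OF that(3) g_le[OF that(1) this]] show "dist 0 y \<le> dist 0 z" by simp
    qed
  qed (fact that)
  have "(\<lambda>t. norm (g t)) \<in> borel_measurable (lebesgue_on I)"
    unfolding borel_measurable_iff_le
  proof
    fix r :: real
    have "{t \<in> space (lebesgue_on I). norm (g t) \<le> r} = {t\<in>I. G t \<inter> (H \<inter> cball 0 r) \<noteq> {}}"
    proof (intro set_eqI iffI)
      fix t assume "t \<in> {t \<in> space (lebesgue_on I). norm (g t) \<le> r}"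
      then show "t \<in> {t\<in>I. G t \<inter> (H \<inter> cball 0 r) \<noteq> {}}" using g[of t] by auto
    next
      fix t assume "t \<in> {t\<in>I. G t \<inter> (H \<inter> cball 0 r) \<noteq> {}}"
      then obtain y where "t \<in> I" "y \<in> G t \<inter> H" "y \<in> cball 0 r" by blast
      then show "t \<in> {t \<in> space (lebesgue_on I). norm (g t) \<le> r}" using g_le[of t y] by simp
    qed
    then show "{t \<in> space (lebesgue_on I). norm (g t) \<le> r} \<in> sets (lebesgue_on I)"
      using hits[of "H \<inter> cball 0 r"] H by auto
  qed
  then have norm_ge: "{t\<in>I. q \<le> norm (g t)} \<in> sets (lebesgue_on I)" for q
    using borel_measurable_iff_ge[of "\<lambda>t. norm (g t)" "lebesgue_on I"] by simp
  have closed: "{t\<in>I. g t \<in> C} \<in> sets (lebesgue_on I)" if C: "closed C" for C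
  proof -
    \<comment> \<open>by compactness the rational \<open>q\<close> may be let tend to \<open>|g t|\<close>, and the point of minimal norm is unique\<close>
    have iff: "g t \<in> C \<longleftrightarrow> (\<forall>q\<in>\<rat>. q \<le> norm (g t) \<or> G t \<inter> (H \<inter> cball 0 q \<inter> C) \<noteq> {})" if t: "t \<in> I" for t
    proof
      assume "g t \<in> C"
      then have "g t \<in> G t \<inter> (H \<inter> cball 0 q \<inter> C)" if "norm (g t) < q" for q
        using g[OF t] that by auto
      then show "\<forall>q\<in>\<rat>. q \<le> norm (g t) \<or> G t \<inter> (H \<inter> cball 0 q \<inter> C) \<noteq> {}"
        by (metis empty_iff not_le)
    next
      assume *: "\<forall>q\<in>\<rat>. q \<le> norm (g t) \<or> G t \<inter> (H \<inter> cball 0 q \<inter> C) \<noteq> {}"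
      define K where "K = G t \<inter> H \<inter> C"
      have K: "closed K" unfolding K_def using cl[OF t] C by auto
      obtain q where "q \<in> \<rat>" "norm (g t) < q" using Rats_dense_in_real[of "norm (g t)" "norm (g t) + 1"] by auto
      then have "G t \<inter> (H \<inter> cball 0 q \<inter> C) \<noteq> {}" using * by (meson not_le)
      then have "K \<noteq> {}" unfolding K_def by blast
      define y where "y = closest_point K 0"
      have y: "y \<in> K" unfolding y_def by (rule closest_point_in_set) fact+
      have "norm y \<le> norm (g t)"
      proof (rule ccontr)
        assume "\<not> norm y \<le> norm (g t)"
        then obtain q where q: "q \<in> \<rat>" "norm (g t) < q" "q < norm y"
          using Rats_dense_in_real[of "norm (g t)" "norm y"] by auto
        then have "G t \<inter> (H \<inter> cball 0 q \<inter> C) \<noteq> {}" using * by (meson not_le)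
        then obtain z where z: "z \<in> K" "z \<in> cball 0 q" unfolding K_def by blast
        show False using closest_point_le[OF K z(1), of 0] z(2) q by (simp add: y_def)
      qed
      then have "y = g t" using g_unique[OF t] y unfolding K_def by blast
      then show "g t \<in> C" using y unfolding K_def by auto
    qed
    have "{t\<in>I. g t \<in> C} = I \<inter> (\<Inter>q\<in>\<rat>. {t\<in>I. q \<le> norm (g t)} \<union> {t\<in>I. G t \<inter> (H \<inter> cball 0 q \<inter> C) \<noteq> {}})"
      using iff by blast
    also have "\<dots> \<in> sets (lebesgue_on I)"
      using C H by (intro sets.Int sets.countable_INT' sets.Un norm_ge hits closed_Int image_subsetI
          countable_rat) auto
    finally show ?thesis .
  qed
  have "g \<in> borel_measurable (lebesgue_on I)"
  proof (rule borel_measurableI)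
    fix S :: "'b set" assume "open S"
    have "g -` S \<inter> space (lebesgue_on I) = space (lebesgue_on I) - {t\<in>I. g t \<in> - S}" by auto
    then show "g -` S \<inter> space (lebesgue_on I) \<in> sets (lebesgue_on I)"
      using closed[of "- S"] \<open>open S\<close> by (metis closed_Compl sets.compl_sets)
  qed
  with g that show ?thesis by blast
qed

text \<open>Nodes of weight zero are left unconstrained. For a partition of unity these are the
  far-away centres, whose values are not under control.\<close>

lemma convex_sum_support:
  fixes g :: "'a \<Rightarrow> 'b::real_vector"
  assumes X: "finite X" and S: "convex S" and nonneg: "\<And>z. z \<in> X \<Longrightarrow> 0 \<le> l z"
    and one: "(\<Sum>z\<in>X. l z) = (1::real)" and g: "\<And>z. z \<in> X \<Longrightarrow> l z > 0 \<Longrightarrow> g z \<in> S"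
  shows "(\<Sum>z\<in>X. l z *\<^sub>R g z) \<in> S"
proof -
  define Y where "Y = {z\<in>X. l z > 0}"
  have Y: "finite Y" "Y \<subseteq> X" using X by (auto simp: Y_def)
  have zero: "l z = 0" if "z \<in> X - Y" for z using nonneg[of z] that by (auto simp: Y_def)
  have "(\<Sum>z\<in>Y. l z) = (\<Sum>z\<in>X. l z)"
    by (rule sum.mono_neutral_left[OF X Y(2)]) (use zero in blast)
  then have "(\<Sum>z\<in>Y. l z *\<^sub>R g z) \<in> S"
    by (intro convex_sum[OF Y(1) S]) (simp_all add: one Y_def nonneg g)
  also have "(\<Sum>z\<in>Y. l z *\<^sub>R g z) = (\<Sum>z\<in>X. l z *\<^sub>R g z)"
    by (rule sum.mono_neutral_left[OF X Y(2)]) (simp add: zero)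
  finally show ?thesis .
qed

text \<open>The right-hand side is a finite sum of weights depending on \<open>c\<close> only times
  selections depending on \<open>t\<close> only. The weights are normalised hat functions of radius
  \<open>\<delta>\<close> around a finite net of the ball, so \<open>f t c\<close> mixes only values
  of \<open>F t\<close> at points closer to \<open>c\<close> than \<open>\<delta>\<close>.\<close>

lemma continuous_approximate_selection:
  fixes F :: "real \<Rightarrow> 'b::euclidean_space \<Rightarrow> 'b set"
  assumes meas: "\<And>z A. closed A \<Longrightarrow> {t\<in>{0..T}. F t z \<subseteq> A} \<in> sets lebesgue"
    and comp: "\<And>t z. t \<in> {0..T} \<Longrightarrow> compact (F t z)" and conv: "\<And>t z. t \<in> {0..T} \<Longrightarrow> convex (F t z)"
    and ne: "\<And>t z. t \<in> {0..T} \<Longrightarrow> F t z \<noteq> {}"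
    and guide: "\<And>t z. norm z \<ge> R \<Longrightarrow> t \<in> {0..T} \<Longrightarrow> \<exists>y\<in>F t z. z \<bullet> y \<le> 0"
    and m: "m integrable_on {0..T}"
    and bound: "\<And>t z y. t \<in> {0..T} \<Longrightarrow> z \<in> cball 0 (R + 1) \<Longrightarrow> y \<in> F t z \<Longrightarrow> norm y \<le> m t"
    and \<delta>: "0 < \<delta>" "\<delta> \<le> 1"
  shows "\<exists>f. (\<forall>c\<in>cball 0 (R + 1). (\<lambda>t. f t c) \<in> borel_measurable (lebesgue_on {0..T})) \<and>
    (\<forall>t\<in>{0..T}. \<forall>c\<in>cball 0 (R + 1). norm (f t c) \<le> m t) \<and>
    (\<forall>a b. 0 \<le> a \<longrightarrow> b \<le> T \<longrightarrow> continuous_on (cball 0 (R + 1)) (\<lambda>c. integral {a..b} (\<lambda>t. f t c))) \<and>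
    (\<forall>t\<in>{0..T}. \<forall>c. norm c = R + 1 \<longrightarrow> c \<bullet> f t c \<le> \<delta> * m t) \<and>
    (\<forall>t\<in>{0..T}. \<forall>c\<in>cball 0 (R + 1). f t c \<in> convex hull (\<Union>z\<in>ball c \<delta>. F t z))"
proof -
  define B where "B = cball (0::'b) (R + 1)"
  have "\<exists>g. g \<in> borel_measurable (lebesgue_on {0..T}) \<and>
      (\<forall>t\<in>{0..T}. g t \<in> F t z \<and> (norm z \<ge> R \<longrightarrow> z \<bullet> g t \<le> 0))" for z
  proof -
    \<comment> \<open>The half-space is imposed only where the guiding condition guarantees that
      \<open>F t z\<close> meets it.\<close>
    define H where "H = (if norm z \<ge> R then {y. z \<bullet> y \<le> 0} else UNIV)"
    have H: "closed H" "convex H"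
      by (simp_all add: H_def closed_halfspace_le convex_halfspace_le)
    have neH: "F t z \<inter> H \<noteq> {}" if "t \<in> {0..T}" for t
      using guide[OF _ that, of z] ne[OF that, of z] by (cases "norm z \<ge> R") (auto simp: H_def)
    obtain g where g: "g \<in> borel_measurable (lebesgue_on {0..T})"
      "\<And>t. t \<in> {0..T} \<Longrightarrow> g t \<in> F t z \<inter> H"
      by (rule measurable_selection_min_norm[OF meas comp conv H neH]) auto
    show ?thesis
    proof (intro exI[of _ g] conjI ballI impI g(1))
      fix t assume t: "t \<in> {0..T}"
      show "g t \<in> F t z" using g(2)[OF t] by blast
      assume "norm z \<ge> R"
      then have "H = {y. z \<bullet> y \<le> 0}" by (simp add: H_def)
      then show "z \<bullet> g t \<le> 0" using g(2)[OF t] by blast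
    qed
  qed
  then obtain g where g_meas: "\<And>z. g z \<in> borel_measurable (lebesgue_on {0..T})"
    and gF: "\<And>z t. t \<in> {0..T} \<Longrightarrow> g z t \<in> F t z"
    and g_guide: "\<And>z t. t \<in> {0..T} \<Longrightarrow> norm z \<ge> R \<Longrightarrow> z \<bullet> g z t \<le> 0"
    by metis
  have "compact B" by (simp add: B_def)
  moreover have "B \<subseteq> (\<Union>z\<in>B. ball z \<delta>)" using \<delta> by auto
  ultimately obtain X where X: "X \<subseteq> B" "finite X" "B \<subseteq> (\<Union>z\<in>X. ball z \<delta>)"
    using compactE_image[of B B "\<lambda>z. ball z \<delta>"] by (metis open_ball)
  define w where "w z c = max 0 (\<delta> - dist c z)" for z c :: 'b
  define l where "l z c = w z c / (\<Sum>u\<in>X. w u c)" for z c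
  define f where "f t c = (\<Sum>z\<in>X. l z c *\<^sub>R g z t)" for t c
  have s_pos: "(\<Sum>u\<in>X. w u c) > 0" if c: "c \<in> B" for c
  proof -
    obtain z where "z \<in> X" "dist z c < \<delta>" using X c by auto
    then show ?thesis
      using X(2) by (intro sum_pos2[of X z]) (auto simp: w_def dist_commute)
  qed
  have l_nonneg: "0 \<le> l z c" if "c \<in> B" for z c
    unfolding l_def using s_pos[OF that] by (auto simp: w_def)
  have l_sum: "(\<Sum>z\<in>X. l z c) = 1" if "c \<in> B" for c
    unfolding l_def using s_pos[OF that] by (simp flip: sum_divide_distrib)
  have l_pos: "dist c z < \<delta>" if "c \<in> B" "l z c > 0" for z c
  proof -
    have "w z c > 0" using that(2) s_pos[OF that(1)] unfolding l_def by (simp add: zero_less_divide_iff)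
    then show ?thesis unfolding w_def by linarith
  qed
  have l_cont: "continuous_on B (l z)" for z
  proof -
    have ne: "(\<Sum>u\<in>X. max 0 (\<delta> - dist c u)) \<noteq> 0" if "c \<in> B" for c
      using s_pos[OF that] unfolding w_def by simp
    show ?thesis
      unfolding l_def[abs_def] w_def by (intro continuous_intros ballI ne)
  qed
  \<comment> \<open>Any convex constraint satisfied by the selections at nearby centres passes to
    \<open>f t c\<close>. Norm bound, inward estimate and hull membership are the cases of a ball, a
    half-space and a convex hull.\<close>
  have f_in: "f t c \<in> S" if "c \<in> B" "convex S" "\<And>z. z \<in> X \<Longrightarrow> dist c z < \<delta> \<Longrightarrow> g z t \<in> S" for t c S
    unfolding f_def
    by (rule convex_sum_support[OF X(2) that(2) l_nonneg[OF that(1)] l_sum[OF that(1)] that(3)[OF _ l_pos[OF that(1)]]])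
  have g_bound: "norm (g z t) \<le> m t" if "z \<in> X" "t \<in> {0..T}" for z t
    using bound[OF that(2) _ gF[OF that(2)]] X(1) that(1) by (auto simp: B_def)
  have g_int: "g z integrable_on {a..b}" if "z \<in> X" "0 \<le> a" "b \<le> T" for z a b
  proof -
    have "g z integrable_on {0..T}"
      by (rule measurable_bounded_by_integrable_imp_integrable[OF g_meas m g_bound[OF that(1)]]) simp_all
    then show ?thesis by (rule integrable_subinterval_real) (use that in auto)
  qed
  show ?thesis
    unfolding B_def[symmetric]
  proof (intro exI[of _ f] conjI ballI allI impI)
    show "(\<lambda>t. f t c) \<in> borel_measurable (lebesgue_on {0..T})" for c
      unfolding f_def by (intro borel_measurable_sum borel_measurable_scaleR g_meas borel_measurable_const)
    show "norm (f t c) \<le> m t" if "t \<in> {0..T}" "c \<in> B" for t c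
      using f_in[OF that(2), of "cball 0 (m t)" t] g_bound that(1) by auto
    \<comment> \<open>Integrating over \<open>t\<close> leaves constant vectors multiplied by the
      weights, so continuity in \<open>c\<close> is that of the weights.\<close>
    show "continuous_on B (\<lambda>c. integral {a..b} (\<lambda>t. f t c))" if "0 \<le> a" "b \<le> T" for a b
    proof -
      have "integral {a..b} (\<lambda>t. f t c) = (\<Sum>z\<in>X. l z c *\<^sub>R integral {a..b} (g z))" for c
        unfolding f_def using g_int that X(2) by (subst integral_sum) (auto intro: integrable_cmul)
      then show ?thesis by (simp only:) (intro continuous_intros l_cont)
    qed
    show "c \<bullet> f t c \<le> \<delta> * m t" if t: "t \<in> {0..T}" and c: "norm c = R + 1" for t c
    proof -
      have "f t c \<in> {y. c \<bullet> y \<le> \<delta> * m t}"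
      proof (rule f_in)
        fix z assume z: "z \<in> X" "dist c z < \<delta>"
        \<comment> \<open>Here the margin of 1 between the radii and \<open>\<delta> \<le> 1\<close>
          are spent. Replacing \<open>z\<close> by \<open>c\<close> in the inward inequality then
          costs at most |c - z| times the bound \<open>m t\<close>.\<close>
        have "norm z \<ge> R" using z \<delta> c norm_triangle_ineq2[of c z] by (simp add: dist_norm)
        then have "z \<bullet> g z t \<le> 0" using g_guide t by blast
        moreover have "(c - z) \<bullet> g z t \<le> norm (c - z) * norm (g z t)" by (rule norm_cauchy_schwarz)
        moreover have "norm (c - z) * norm (g z t) \<le> \<delta> * m t"
          using z g_bound[OF z(1) t] \<delta> by (intro mult_mono) (auto simp: dist_norm)
        ultimately show "g z t \<in> {y. c \<bullet> y \<le> \<delta> * m t}" by (simp add: inner_diff_left)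
      qed (use c in \<open>auto simp: B_def convex_halfspace_le\<close>)
      then show ?thesis by simp
    qed
    show "f t c \<in> convex hull (\<Union>z\<in>ball c \<delta>. F t z)" if "t \<in> {0..T}" "c \<in> B" for t c
    proof (rule f_in[OF that(2) convex_convex_hull])
      fix z assume "dist c z < \<delta>"
      then show "g z t \<in> convex hull (\<Union>z\<in>ball c \<delta>. F t z)"
        using gF[OF that(1)] by (intro hull_inc UN_I[of z]) auto
    qed
  qed
qed

section \<open>Euler polygons\<close>

lemma closest_point_cball_outside:
  fixes p :: "'b::euclidean_space"
  assumes "0 < \<rho>" "\<rho> \<le> norm p"
  shows "closest_point (cball 0 \<rho>) p = (\<rho> / norm p) *\<^sub>R p"
proof (rule closest_point_unique[symmetric])
  have "norm p > 0" using assms by linarith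
  then show "(\<rho> / norm p) *\<^sub>R p \<in> cball 0 \<rho>" using assms by simp
  have "p - (\<rho> / norm p) *\<^sub>R p = (1 - \<rho> / norm p) *\<^sub>R p" by (simp add: scaleR_diff_left)
  then have "dist p ((\<rho> / norm p) *\<^sub>R p) = norm p - \<rho>"
    using assms \<open>norm p > 0\<close> by (simp add: dist_norm abs_of_nonneg left_diff_distrib)
  moreover have "norm p - \<rho> \<le> dist p z" if "z \<in> cball 0 \<rho>" for z
    using that norm_triangle_ineq2[of p z] by (simp add: dist_norm)
  ultimately show "\<forall>z\<in>cball 0 \<rho>. dist p ((\<rho> / norm p) *\<^sub>R p) \<le> dist p z" by simp
qed auto

text \<open>A step from inside the ball overshoots by at most \<open>\<delta>\<close>. From outside,
  expanding |p + \<Delta>|^2 shows that the norm grows by at most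
  \<open>2 * \<delta> / \<rho> * M\<close>: both the inner product and the quadratic term are of
  order \<open>\<delta> * M\<close>, the latter since \<open>M \<le> \<delta>\<close>.
  \<open>K\<close> is the growth accumulated in earlier steps.\<close>

lemma guided_step_norm_le:
  fixes p \<Delta> :: "'b::euclidean_space"
  assumes "0 < \<rho>" "0 \<le> \<delta>" "norm \<Delta> \<le> M" "M \<le> \<delta>"
    and guide: "\<rho> < norm p \<Longrightarrow> closest_point (cball 0 \<rho>) p \<bullet> \<Delta> \<le> \<delta> * M"
    and p: "norm p \<le> \<rho> + \<delta> + K"  and "0 \<le> K"
  shows "norm (p + \<Delta>) \<le> \<rho> + \<delta> + (K + 2 * \<delta> / \<rho> * M)"
proof -
  have M: "0 \<le> M" using assms(3) norm_ge_zero order_trans by blast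
  then have KM: "0 \<le> 2 * \<delta> / \<rho> * M" using assms by simp
  show ?thesis
  proof (cases "norm p \<le> \<rho>")
    case True
    then show ?thesis using norm_triangle_ineq[of p \<Delta>] assms KM by linarith
  next
    case False
    \<comment> \<open>The guiding hypothesis concerns the projection of \<open>p\<close>, which is
      \<open>p\<close> scaled by \<rho>/|p|; undoing the scaling gives the factor |p|/\<rho>. This
      factor is what later completes the square.\<close>
    define Y where "Y = norm p / \<rho> * (\<delta> * M)"
    have "norm p > 0" using assms(1) False by linarith
    have "\<rho> / norm p * (p \<bullet> \<Delta>) \<le> \<delta> * M"
      using guide closest_point_cball_outside[of \<rho> p] assms False by simp
    then have "p \<bullet> \<Delta> \<le> Y"
      using assms(1) \<open>norm p > 0\<close> by (simp add: Y_def field_simps)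
    moreover have "norm \<Delta> ^ 2 \<le> 2 * Y"
    proof -
      have "norm \<Delta> ^ 2 \<le> M * M" unfolding power2_eq_square using assms(3) M by (intro mult_mono) auto
      also have "\<dots> \<le> \<delta> * M" using assms M by (intro mult_right_mono) auto
      also have "\<dots> \<le> 2 * Y"
      proof -
        have "1 * (\<delta> * M) \<le> Y"
          unfolding Y_def using assms(1,2) False M by (intro mult_right_mono) auto
        moreover have "0 \<le> Y" unfolding Y_def using assms(1,2) M by simp
        ultimately show ?thesis by linarith
      qed
      finally show ?thesis .
    qed
    moreover have "norm (p + \<Delta>) ^ 2 = norm p ^ 2 + 2 * (p \<bullet> \<Delta>) + norm \<Delta> ^ 2"
      by (simp add: power2_norm_eq_inner inner_simps inner_commute)
    ultimately have "norm (p + \<Delta>) ^ 2 \<le> norm p ^ 2 + 4 * Y" by linarith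
    also have "\<dots> = norm p ^ 2 + 2 * norm p * (2 * \<delta> / \<rho> * M)"
      by (simp add: Y_def)
    also have "\<dots> \<le> (norm p + 2 * \<delta> / \<rho> * M) ^ 2"
      unfolding power2_sum by simp
    finally have "norm (p + \<Delta>) \<le> norm p + 2 * \<delta> / \<rho> * M"
      by (rule power2_le_imp_le) (use KM in simp)
    then show ?thesis using p by linarith
  qed
qed

text \<open>\<open>u x\<close> is the derivative of the polygon starting at \<open>x\<close>: along
  each step \<open>f\<close> is evaluated at the projection of the last node. Projecting keeps this
  argument where \<open>f\<close> is controlled and, when the node is outside the ball, puts it on
  the sphere, where \<open>f\<close> almost points inwards.\<close>

lemma guided_euler_family:
  fixes f :: "real \<Rightarrow> 'b::euclidean_space \<Rightarrow> 'b"
  defines "r \<rho> \<equiv> closest_point (cball (0::'b) \<rho>)"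
  assumes "0 \<le> T" and \<rho>: "0 < \<rho>" and \<delta>: "0 < \<delta>"
    and m: "m integrable_on {0..T}"
    and f_meas: "\<And>c. c \<in> cball 0 \<rho> \<Longrightarrow> (\<lambda>t. f t c) \<in> borel_measurable (lebesgue_on {0..T})"
    and f_bound: "\<And>t c. t \<in> {0..T} \<Longrightarrow> c \<in> cball 0 \<rho> \<Longrightarrow> norm (f t c) \<le> m t"
    and f_cont: "\<And>a b. 0 \<le> a \<Longrightarrow> b \<le> T \<Longrightarrow> continuous_on (cball 0 \<rho>) (\<lambda>c. integral {a..b} (\<lambda>t. f t c))"
    and f_guide: "\<And>t c. t \<in> {0..T} \<Longrightarrow> norm c = \<rho> \<Longrightarrow> c \<bullet> f t c \<le> \<delta> * m t"
  shows "\<exists>u. (\<forall>x. u x \<in> borel_measurable (lebesgue_on {0..T})) \<and>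
    (\<forall>x. \<forall>t\<in>{0..T}. norm (u x t) \<le> m t) \<and>
    (\<forall>t\<in>{0..T}. continuous_on UNIV (\<lambda>x. x + integral {0..t} (u x))) \<and>
    (\<forall>x\<in>cball 0 \<rho>. \<forall>t\<in>{0..T}.
       norm (x + integral {0..t} (u x)) \<le> \<rho> + \<delta> + 2 * \<delta> / \<rho> * integral {0..t} m) \<and>
    (\<forall>x. \<forall>t\<in>{0..T}. \<exists>c\<in>cball 0 \<rho>.
       dist c (r \<rho> (x + integral {0..t} (u x))) \<le> \<delta> \<and> u x t = f t c)"
proof -
  \<comment> \<open>Measurability and the bound are required on the whole interval, so that
    \<open>u\<close> can be integrated anywhere; the properties of the polygon itself are required
    only up to time \<open>s\<close>.\<close>
  define Good where "Good s u \<longleftrightarrow>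
    (\<forall>x. u x \<in> borel_measurable (lebesgue_on {0..T})) \<and>
    (\<forall>x. \<forall>t\<in>{0..T}. norm (u x t) \<le> m t) \<and>
    (\<forall>t\<in>{0..s}. continuous_on UNIV (\<lambda>x. x + integral {0..t} (u x))) \<and>
    (\<forall>x\<in>cball 0 \<rho>. \<forall>t\<in>{0..s}.
       norm (x + integral {0..t} (u x)) \<le> \<rho> + \<delta> + 2 * \<delta> / \<rho> * integral {0..t} m) \<and>
    (\<forall>x. \<forall>t\<in>{0..s}. \<exists>c\<in>cball 0 \<rho>.
       dist c (r \<rho> (x + integral {0..t} (u x))) \<le> \<delta> \<and> u x t = f t c)" for s u
  have ball: "convex (cball (0::'b) \<rho>)" "closed (cball (0::'b) \<rho>)" "cball (0::'b) \<rho> \<noteq> {}"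
    using \<rho> by auto
  have r_in: "r \<rho> x \<in> cball 0 \<rho>" for x
    unfolding r_def by (rule closest_point_in_set[OF ball(2,3)])
  have r_cont: "continuous_on UNIV (r \<rho>)"
    unfolding r_def by (rule continuous_on_closest_point[OF ball])
  have r_lip: "dist (r \<rho> x) (r \<rho> y) \<le> dist x y" for x y
    unfolding r_def by (rule closest_point_lipschitz[OF ball])
  have m_nonneg: "0 \<le> m t" if "t \<in> {0..T}" for t
    using f_bound[OF that, of 0] \<rho> norm_ge_zero[of "f t 0"] by (smt (verit) centre_in_cball)
  have m_int: "m integrable_on {a..b}" if "0 \<le> a" "b \<le> T" for a b
    by (rule integrable_subinterval_real[OF m]) (use that in auto)
  have m_int_nonneg: "0 \<le> integral {a..b} m" if "0 \<le> a" "b \<le> T" for a b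
    using that m_nonneg by (intro Henstock_Kurzweil_Integration.integral_nonneg m_int) auto
  have int: "g integrable_on {a..b}"
    if "g \<in> borel_measurable (lebesgue_on {0..T})" "\<And>t. t \<in> {0..T} \<Longrightarrow> norm (g t) \<le> m t" "0 \<le> a" "b \<le> T"
    for g :: "real \<Rightarrow> 'b" and a b
  proof -
    have "g integrable_on {0..T}"
      by (rule measurable_bounded_by_integrable_imp_integrable[OF that(1) m that(2)]) auto
    then show ?thesis by (rule integrable_subinterval_real) (use that in auto)
  qed
  have int_bound: "norm (integral {a..b} g) \<le> integral {a..b} m"
    if "g \<in> borel_measurable (lebesgue_on {0..T})" "\<And>t. t \<in> {0..T} \<Longrightarrow> norm (g t) \<le> m t" "0 \<le> a" "b \<le> T"
    for g :: "real \<Rightarrow> 'b" and a b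
    using that by (intro Henstock_Kurzweil_Integration.integral_norm_bound_integral int m_int) auto
  \<comment> \<open>Up to time 0 only the initial point matters. The value at time 0 must still be
    of the form \<open>f t c\<close>, which the projected initial point provides.\<close>
  have start: "Good 0 (\<lambda>x t. f t (r \<rho> x))"
    unfolding Good_def using f_meas f_bound r_in \<delta>
    by (auto intro!: continuous_intros bexI[OF _ r_in])
  have step: "\<exists>u'. Good s' u'" if u: "Good s u" and s: "0 \<le> s" "s \<le> s'" "s' \<le> T"
    and small: "integral {s..s'} m \<le> \<delta>" for s s' u
  proof -
    have u_meas: "u x \<in> borel_measurable (lebesgue_on {0..T})"
      and u_bound: "t \<in> {0..T} \<Longrightarrow> norm (u x t) \<le> m t" for x t
      using u unfolding Good_def by auto
    define p where "p x = x + integral {0..s} (u x)" for x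
    have p_cont: "continuous_on UNIV p"
      using u s unfolding Good_def p_def[abs_def] by auto
    define u' where "u' x t = (if t \<le> s then u x t else f t (r \<rho> (p x)))" for x t
    have u'_meas: "u' x \<in> borel_measurable (lebesgue_on {0..T})" for x
      unfolding u'_def[abs_def]
    proof (rule measurable_If[OF u_meas f_meas[OF r_in]])
      have "{t \<in> space (lebesgue_on {0..T}). t \<le> s} = {0..min s T}" by auto
      then show "{t \<in> space (lebesgue_on {0..T}). t \<le> s} \<in> sets (lebesgue_on {0..T})"
        by (simp add: sets_restrict_space_iff)
    qed
    have u'_bound: "norm (u' x t) \<le> m t" if "t \<in> {0..T}" for x t
      unfolding u'_def using u_bound f_bound r_in that by auto
    define \<Delta> where "\<Delta> x t = integral {s..t} (\<lambda>\<tau>. f \<tau> (r \<rho> (p x)))" for x t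
    have \<Delta>_le: "norm (\<Delta> x t) \<le> integral {s..t} m" if "t \<in> {s..s'}" for x t
      unfolding \<Delta>_def using f_meas[OF r_in] f_bound r_in s that by (intro int_bound) auto
    have M_le: "integral {s..t} m \<le> \<delta>" if "t \<in> {s..s'}" for t
    proof -
      have "integral {s..t} m \<le> integral {s..s'} m"
        using s that m_nonneg by (intro integral_subset_le m_int) auto
      then show ?thesis using small by simp
    qed
    have old: "integral {0..t} (u' x) = integral {0..t} (u x)" if "t \<in> {0..s}" for x t
      using that by (intro Henstock_Kurzweil_Integration.integral_cong) (auto simp: u'_def)
    have new: "x + integral {0..t} (u' x) = p x + \<Delta> x t" if "t \<in> {s..s'}" for x t
    proof -
      have "integral {0..t} (u' x) = integral {0..s} (u' x) + integral {s..t} (u' x)"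
        using that s int[OF u'_meas u'_bound]
        by (intro Henstock_Kurzweil_Integration.integral_combine[symmetric]) auto
      moreover have "integral {s..t} (u' x) = \<Delta> x t"
        unfolding \<Delta>_def by (rule integral_spike[of "{s}"]) (auto simp: u'_def)
      ultimately show ?thesis using old[of s x] s by (simp add: p_def)
    qed
    have "Good s' u'"
      unfolding Good_def
    proof (intro conjI allI ballI)
      show "u' x \<in> borel_measurable (lebesgue_on {0..T})" for x by (rule u'_meas)
      show "norm (u' x t) \<le> m t" if "t \<in> {0..T}" for x t using that by (rule u'_bound)
      show "continuous_on UNIV (\<lambda>x. x + integral {0..t} (u' x))" if "t \<in> {0..s'}" for t
      proof (cases "t \<le> s")
        case True
        then have "t \<in> {0..s}" using that by auto
        then show ?thesis using u unfolding Good_def old[OF \<open>t \<in> {0..s}\<close>] by blast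
      next
        case False
        then have t: "t \<in> {s..s'}" using that by auto
        \<comment> \<open>With the argument frozen, the increment is the continuous map
          \<open>c \<mapsto> integral {s..t} (\<lambda>t. f t c)\<close> evaluated at the projected
          node, which depends continuously on \<open>x\<close>.\<close>
        have "continuous_on UNIV (\<lambda>x. \<Delta> x t)"
          unfolding \<Delta>_def
          by (rule continuous_on_compose2[OF f_cont continuous_on_compose2[OF r_cont p_cont]])
            (use s t r_in in auto)
        then show ?thesis unfolding new[OF t] by (intro continuous_on_add p_cont)
      qed
      show "norm (x + integral {0..t} (u' x)) \<le> \<rho> + \<delta> + 2 * \<delta> / \<rho> * integral {0..t} m"
        if x: "x \<in> cball 0 \<rho>" and t: "t \<in> {0..s'}" for x t
      proof (cases "t \<le> s")
        case True
        then have "t \<in> {0..s}" using t by auto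
        then show ?thesis using u x unfolding Good_def old[OF \<open>t \<in> {0..s}\<close>] by blast
      next
        case False
        then have t': "t \<in> {s..s'}" using t by auto
        \<comment> \<open>The growth of each step is proportional to the integral of
          \<open>m\<close> over it. The contributions therefore add up to an integral over
          \<open>{0..t}\<close>, independently of the number of nodes.\<close>
        have "norm (p x + \<Delta> x t) \<le> \<rho> + \<delta> + (2 * \<delta> / \<rho> * integral {0..s} m + 2 * \<delta> / \<rho> * integral {s..t} m)"
        proof (rule guided_step_norm_le[OF \<rho> less_imp_le[OF \<delta>] \<Delta>_le[OF t'] M_le[OF t']])
          show "norm (p x) \<le> \<rho> + \<delta> + 2 * \<delta> / \<rho> * integral {0..s} m"
            using u x s unfolding Good_def p_def by auto
          show "0 \<le> 2 * \<delta> / \<rho> * integral {0..s} m"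
            using \<rho> \<delta> m_int_nonneg[of 0 s] s by simp
          assume out: "\<rho> < norm (p x)"
          define c where "c = r \<rho> (p x)"
          have c: "norm c = \<rho>" "c \<in> cball 0 \<rho>"
            using closest_point_cball_outside[of \<rho> "p x"] out \<rho> unfolding c_def r_def by auto
          have fi: "(\<lambda>\<tau>. f \<tau> c) integrable_on {s..t}"
            using f_meas[OF c(2)] f_bound[OF _ c(2)] s t' by (intro int) auto
          \<comment> \<open>Since \<open>c\<close> does not move during the step, the pointwise
            inward estimate can be integrated.\<close>
          have "c \<bullet> \<Delta> x t = integral {s..t} (\<lambda>\<tau>. c \<bullet> f \<tau> c)"
            unfolding \<Delta>_def c_def[symmetric]
            using integral_linear[OF fi bounded_linear_inner_right[of c]] by (simp add: o_def)
          also have "\<dots> \<le> integral {s..t} (\<lambda>\<tau>. \<delta> * m \<tau>)"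
            using f_guide c(1) s t' integrable_linear[OF fi bounded_linear_inner_right[of c]]
            by (intro integral_le integrable_on_mult_right m_int) (auto simp: o_def)
          also have "\<dots> = \<delta> * integral {s..t} m" by simp
          finally show "closest_point (cball 0 \<rho>) (p x) \<bullet> \<Delta> x t \<le> \<delta> * integral {s..t} m"
            by (simp add: c_def r_def)
        qed
        moreover have "integral {0..s} m + integral {s..t} m = integral {0..t} m"
          using s t' m_int by (intro Henstock_Kurzweil_Integration.integral_combine) auto
        ultimately show ?thesis unfolding new[OF t'] by (metis distrib_left)
      qed
      show "\<exists>c\<in>cball 0 \<rho>. dist c (r \<rho> (x + integral {0..t} (u' x))) \<le> \<delta> \<and> u' x t = f t c"
        if t: "t \<in> {0..s'}" for x t
      proof (cases "t \<le> s")
        case True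
        then have "t \<in> {0..s}" using t by auto
        moreover have "u' x t = u x t" using True by (simp add: u'_def)
        ultimately show ?thesis using u unfolding Good_def old[OF \<open>t \<in> {0..s}\<close>] by simp
      next
        case False
        then have t': "t \<in> {s..s'}" using t by auto
        have "dist (p x) (p x + \<Delta> x t) \<le> \<delta>"
          using \<Delta>_le[OF t', of x] M_le[OF t'] by (simp add: dist_norm)
        then have "dist (r \<rho> (p x)) (r \<rho> (p x + \<Delta> x t)) \<le> \<delta>"
          using r_lip order_trans by blast
        then show ?thesis
          unfolding new[OF t'] using False by (intro bexI[OF _ r_in[of "p x"]]) (simp add: u'_def)
      qed
    qed
    then show ?thesis by blast
  qed
  \<comment> \<open>This yields a step length \<open>d / 2\<close> over which \<open>m\<close>
    integrates to at most \<open>\<delta>\<close>; the halving meets the strict inequality in the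
    modulus. The last node is cut off at \<open>T\<close>.\<close>
  have "uniformly_continuous_on {0..T} (\<lambda>t. integral {0..t} m)"
    using indefinite_integral_continuous_1[OF m] by (rule compact_uniformly_continuous) simp
  then obtain d where "d > 0" and d: "\<And>a b. a \<in> {0..T} \<Longrightarrow> b \<in> {0..T} \<Longrightarrow> \<bar>b - a\<bar> < d \<Longrightarrow>
      \<bar>integral {0..b} m - integral {0..a} m\<bar> < \<delta>"
    using \<delta> unfolding uniformly_continuous_on_def dist_real_def by metis
  have "\<exists>u. Good (min T (real j * (d / 2))) u" for j
  proof (induction j)
    case 0
    then show ?case using start \<open>0 \<le> T\<close> by auto
  next
    case (Suc j)
    define s s' where "s = min T (real j * (d / 2))" and "s' = min T (real (Suc j) * (d / 2))"
    define a where "a = real j * (d / 2)"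
    have "real (Suc j) * (d / 2) = a + d / 2" by (simp add: a_def algebra_simps add_divide_distrib)
    then have "s' = min T (a + d / 2)" unfolding s'_def by (rule arg_cong)
    moreover have "s = min T a" unfolding s_def a_def ..
    moreover have "0 \<le> a" using \<open>d > 0\<close> by (simp add: a_def)
    ultimately have s: "0 \<le> s" "s \<le> s'" "s' \<le> T" "s' - s < d"
      using \<open>d > 0\<close> \<open>0 \<le> T\<close> by linarith+
    have "integral {0..s} m + integral {s..s'} m = integral {0..s'} m"
      using s m_int by (intro Henstock_Kurzweil_Integration.integral_combine) auto
    then have "integral {s..s'} m \<le> \<delta>"
      using d[of s s'] s by auto
    then show ?case using Suc step[OF _ s(1-3)] unfolding s_def[symmetric] s'_def[symmetric] by blast
  qed
  moreover obtain j :: nat where "T / (d / 2) < real j" using reals_Archimedean2 by blast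
  then have "min T (real j * (d / 2)) = T" using \<open>d > 0\<close> by (auto simp: field_simps min_def)
  ultimately have "\<exists>u. Good T u" by metis
  then show ?thesis unfolding Good_def .
qed

section \<open>The nonlocal problem\<close>

lemma nonlocal_approximate_solution:
  fixes F :: "real \<Rightarrow> 'b::euclidean_space \<Rightarrow> 'b set" and \<alpha> \<tau> :: "'i \<Rightarrow> real"
  defines "r R \<equiv> closest_point (cball (0::'b) (R + 1))"
  assumes meas: "\<And>z A. closed A \<Longrightarrow> {t\<in>{0..T}. F t z \<subseteq> A} \<in> sets lebesgue"
    and comp: "\<And>t z. t \<in> {0..T} \<Longrightarrow> compact (F t z)" and conv: "\<And>t z. t \<in> {0..T} \<Longrightarrow> convex (F t z)"
    and ne: "\<And>t z. t \<in> {0..T} \<Longrightarrow> F t z \<noteq> {}"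
    and guide: "\<And>t z. norm z \<ge> R \<Longrightarrow> t \<in> {0..T} \<Longrightarrow> \<exists>y\<in>F t z. z \<bullet> y \<le> 0"
    and m: "m integrable_on {0..T}"
    and bound: "\<And>t z y. t \<in> {0..T} \<Longrightarrow> z \<in> cball 0 (R + 1) \<Longrightarrow> y \<in> F t z \<Longrightarrow> norm y \<le> m t"
    and \<delta>: "0 < \<delta>" "\<delta> \<le> 1" and "0 \<le> T" "0 < R"
    and \<tau>: "\<And>i. i \<in> J \<Longrightarrow> \<tau> i \<in> {0..T}"
  shows "\<exists>u x. u \<in> borel_measurable (lebesgue_on {0..T}) \<and>
    (\<forall>t\<in>{0..T}. norm (u t) \<le> m t) \<and>
    (\<forall>t\<in>{0..T}. x t = x 0 + integral {0..t} u) \<and>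
    (\<forall>t\<in>{0..T}. norm (x t) \<le> R + 1 + \<delta> + 2 * \<delta> / (R + 1) * integral {0..T} m) \<and>
    x 0 = r R (\<Sum>i\<in>J. \<alpha> i *\<^sub>R x (\<tau> i)) \<and>
    (\<forall>t\<in>{0..T}. u t \<in> convex hull (\<Union>z\<in>ball (r R (x t)) (2 * \<delta>). F t z))"
proof -
  have "\<exists>f. (\<forall>c\<in>cball 0 (R + 1). (\<lambda>t. f t c) \<in> borel_measurable (lebesgue_on {0..T})) \<and>
    (\<forall>t\<in>{0..T}. \<forall>c\<in>cball 0 (R + 1). norm (f t c) \<le> m t) \<and>
    (\<forall>a b. 0 \<le> a \<longrightarrow> b \<le> T \<longrightarrow> continuous_on (cball 0 (R + 1)) (\<lambda>c. integral {a..b} (\<lambda>t. f t c))) \<and>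
    (\<forall>t\<in>{0..T}. \<forall>c. norm c = R + 1 \<longrightarrow> c \<bullet> f t c \<le> \<delta> * m t) \<and>
    (\<forall>t\<in>{0..T}. \<forall>c\<in>cball 0 (R + 1). f t c \<in> convex hull (\<Union>z\<in>ball c \<delta>. F t z))"
    by (rule continuous_approximate_selection) (fact meas comp conv ne guide m bound \<delta>)+
  then obtain f where f:
    "\<And>c. c \<in> cball 0 (R + 1) \<Longrightarrow> (\<lambda>t. f t c) \<in> borel_measurable (lebesgue_on {0..T})"
    "\<And>t c. t \<in> {0..T} \<Longrightarrow> c \<in> cball 0 (R + 1) \<Longrightarrow> norm (f t c) \<le> m t"
    "\<And>a b. 0 \<le> a \<Longrightarrow> b \<le> T \<Longrightarrow> continuous_on (cball 0 (R + 1)) (\<lambda>c. integral {a..b} (\<lambda>t. f t c))"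
    "\<And>t c. t \<in> {0..T} \<Longrightarrow> norm c = R + 1 \<Longrightarrow> c \<bullet> f t c \<le> \<delta> * m t"
    and f_hull: "\<And>t c. t \<in> {0..T} \<Longrightarrow> c \<in> cball 0 (R + 1) \<Longrightarrow> f t c \<in> convex hull (\<Union>z\<in>ball c \<delta>. F t z)"
    by blast
  have R1: "0 < R + 1" using \<open>0 < R\<close> by simp
  have "\<exists>u. (\<forall>x. u x \<in> borel_measurable (lebesgue_on {0..T})) \<and>
    (\<forall>x. \<forall>t\<in>{0..T}. norm (u x t) \<le> m t) \<and>
    (\<forall>t\<in>{0..T}. continuous_on UNIV (\<lambda>x. x + integral {0..t} (u x))) \<and>
    (\<forall>x\<in>cball 0 (R + 1). \<forall>t\<in>{0..T}.
       norm (x + integral {0..t} (u x)) \<le> R + 1 + \<delta> + 2 * \<delta> / (R + 1) * integral {0..t} m) \<and>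
    (\<forall>x. \<forall>t\<in>{0..T}. \<exists>c\<in>cball 0 (R + 1).
       dist c (r R (x + integral {0..t} (u x))) \<le> \<delta> \<and> u x t = f t c)"
    unfolding r_def by (rule guided_euler_family) (fact \<open>0 \<le> T\<close> R1 \<delta> m f)+
  then obtain u where u:
    "\<And>x. u x \<in> borel_measurable (lebesgue_on {0..T})"
    "\<And>x t. t \<in> {0..T} \<Longrightarrow> norm (u x t) \<le> m t"
    "\<And>t. t \<in> {0..T} \<Longrightarrow> continuous_on UNIV (\<lambda>x. x + integral {0..t} (u x))"
    "\<And>x t. x \<in> cball 0 (R + 1) \<Longrightarrow> t \<in> {0..T} \<Longrightarrow>
       norm (x + integral {0..t} (u x)) \<le> R + 1 + \<delta> + 2 * \<delta> / (R + 1) * integral {0..t} m"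
    and u_f: "\<And>x t. t \<in> {0..T} \<Longrightarrow>
       \<exists>c\<in>cball 0 (R + 1). dist c (r R (x + integral {0..t} (u x))) \<le> \<delta> \<and> u x t = f t c"
    by blast
  have ball: "convex (cball (0::'b) (R + 1))" "closed (cball (0::'b) (R + 1))" "cball (0::'b) (R + 1) \<noteq> {}"
    using \<open>0 < R\<close> by auto
  define P where "P x0 = r R (\<Sum>i\<in>J. \<alpha> i *\<^sub>R (x0 + integral {0..\<tau> i} (u x0)))" for x0
  have "continuous_on (cball 0 (R + 1)) P"
    unfolding P_def r_def
    by (rule continuous_on_compose2[OF continuous_on_closest_point[OF ball, of UNIV]])
      (auto intro!: continuous_on_sum continuous_on_scaleR continuous_on_const continuous_on_subset[OF u(3)] \<tau>)
  moreover have "P \<in> cball 0 (R + 1) \<rightarrow> cball 0 (R + 1)"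
    unfolding P_def r_def using closest_point_in_set[OF ball(2,3)] by blast
  ultimately obtain x0 where x0: "x0 \<in> cball 0 (R + 1)" "P x0 = x0"
    using brouwer[OF compact_cball ball(1,3)] by blast
  define x where "x t = x0 + integral {0..t} (u x0)" for t
  have x_0: "x 0 = x0" by (simp add: x_def)
  show ?thesis
  proof (rule exI[of _ "u x0"], rule exI[of _ x], intro conjI ballI)
    show "u x0 \<in> borel_measurable (lebesgue_on {0..T})" by (rule u(1))
    show "x 0 = r R (\<Sum>i\<in>J. \<alpha> i *\<^sub>R x (\<tau> i))"
      using x0(2) unfolding x_0 P_def x_def by simp
  next
    fix t assume "t \<in> {0..T}"
    then show "norm (u x0 t) \<le> m t" by (rule u(2))
  next
    show "x t = x 0 + integral {0..t} (u x0)" for t unfolding x_0 by (simp add: x_def)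
  next
    fix t assume t: "t \<in> {0..T}"
    have m_nonneg: "0 \<le> m s" if "s \<in> {0..T}" for s
      using u(2)[OF that, of x0] norm_ge_zero order_trans by blast
    have "integral {0..t} m \<le> integral {0..T} m"
      using t m_nonneg by (intro integral_subset_le m integrable_subinterval_real[OF m]) auto
    then have "2 * \<delta> / (R + 1) * integral {0..t} m \<le> 2 * \<delta> / (R + 1) * integral {0..T} m"
      using \<delta> \<open>0 < R\<close> by (intro mult_left_mono) auto
    then show "norm (x t) \<le> R + 1 + \<delta> + 2 * \<delta> / (R + 1) * integral {0..T} m"
      using u(4)[OF x0(1) t] unfolding x_def by linarith
  next
    fix t assume t: "t \<in> {0..T}"
    obtain c where c: "c \<in> cball 0 (R + 1)" "dist c (r R (x t)) \<le> \<delta>" "u x0 t = f t c"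
      using u_f[OF t, of x0] unfolding x_def by blast
    have "ball c \<delta> \<subseteq> ball (r R (x t)) (2 * \<delta>)"
    proof
      fix z assume "z \<in> ball c \<delta>"
      then show "z \<in> ball (r R (x t)) (2 * \<delta>)"
        using c(2) dist_triangle[of "r R (x t)" z c] by (simp add: dist_commute)
    qed
    then have "convex hull (\<Union>z\<in>ball c \<delta>. F t z) \<subseteq> convex hull (\<Union>z\<in>ball (r R (x t)) (2 * \<delta>). F t z)"
      by (intro hull_mono UN_mono) auto
    then show "u x0 t \<in> convex hull (\<Union>z\<in>ball (r R (x t)) (2 * \<delta>). F t z)"
      using f_hull[OF t c(1)] c(3) by auto
  qed
qed

text \<open>Having an integral within \<epsilon> of \<open>c\<close> is a convex condition. It lets
  the combined derivatives inherit the increments of the approximate solutions.\<close>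

lemma midpoint_hull_integral:
  fixes A :: "(real \<Rightarrow> 'b::euclidean_space) set"
  assumes "g \<in> midpoint_hull A"
    and A: "\<And>f. f \<in> A \<Longrightarrow> f integrable_on S \<and> norm (integral S f - c) \<le> \<epsilon>"
  shows "g integrable_on S \<and> norm (integral S g - c) \<le> \<epsilon>"
  using assms(1)
proof induction
  case (midpoint f g)
  then have "integral S (\<lambda>t. (1/2) *\<^sub>R (f t + g t)) - c = (1/2) *\<^sub>R ((integral S f - c) + (integral S g - c))"
    by (simp add: integral_add algebra_simps flip: scaleR_left_distrib)
  moreover have "norm ((1/2) *\<^sub>R ((integral S f - c) + (integral S g - c))) \<le> \<epsilon>"
    using midpoint norm_triangle_ineq[of "integral S f - c" "integral S g - c"] by simp
  ultimately show ?case using midpoint by (auto intro!: integrable_cmul integrable_add)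
qed (rule A)

text \<open>Produces a negligible set, the form in which gauge integrals can ignore exceptional
  points.\<close>

lemma AE_lebesgue_on_imp_negligible:
  assumes "AE t in lebesgue_on S. P t" "S \<in> sets lebesgue"
  shows "\<exists>N. negligible N \<and> (\<forall>t\<in>S. t \<notin> N \<longrightarrow> P t)"
proof -
  obtain N where "{t \<in> space (lebesgue_on S). \<not> P t} \<subseteq> N" "emeasure (lebesgue_on S) N = 0"
      "N \<in> sets (lebesgue_on S)"
    using assms(1) by (rule AE_E)
  then have N: "N \<in> null_sets (lebesgue_on S)" "{t \<in> space (lebesgue_on S). \<not> P t} \<subseteq> N"
    by (auto intro: null_setsI)
  then have "negligible N"
    using assms(2) by (simp add: null_sets_restrict_space negligible_iff_null_sets)
  then show ?thesis using N by auto
qed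

text \<open>The potential enters only through the inward condition, and a bound for \<open>F\<close>
  on the ball is enough because all selections are taken at points of the ball. The conclusion is in
  integrated form; differentiability and absolute continuity of \<open>x\<close> follow from
  it.\<close>

lemma guided_nonlocal_solution:
  fixes F :: "real \<Rightarrow> 'b::euclidean_space \<Rightarrow> 'b set" and \<alpha> \<tau> :: "'i \<Rightarrow> real"
  assumes meas: "\<And>z A. closed A \<Longrightarrow> {t\<in>{0..T}. F t z \<subseteq> A} \<in> sets lebesgue"
    and comp: "\<And>t z. t \<in> {0..T} \<Longrightarrow> compact (F t z)" and conv: "\<And>t z. t \<in> {0..T} \<Longrightarrow> convex (F t z)"
    and ne: "\<And>t z. t \<in> {0..T} \<Longrightarrow> F t z \<noteq> {}"
    and usc: "AE t in lebesgue_on {0..T}. upper_semicontinuous (F t)"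
    and guide: "\<And>t z. norm z \<ge> R \<Longrightarrow> t \<in> {0..T} \<Longrightarrow> \<exists>y\<in>F t z. z \<bullet> y \<le> 0"
    and m: "integrable (lebesgue_on {0..T}) m" and m_pos: "\<And>t. t \<in> {0..T} \<Longrightarrow> 0 < m t"
    and bound: "\<And>t z y. t \<in> {0..T} \<Longrightarrow> z \<in> cball 0 (R + 1) \<Longrightarrow> y \<in> F t z \<Longrightarrow> norm y \<le> m t"
    and "0 \<le> T" "0 < R"
    and \<tau>: "\<And>i. i \<in> J \<Longrightarrow> \<tau> i \<in> {0..T}" and \<alpha>: "(\<Sum>i\<in>J. \<bar>\<alpha> i\<bar>) \<le> 1"
  shows "\<exists>x y. y absolutely_integrable_on {0..T} \<and>
    (\<forall>t\<in>{0..T}. x t = x 0 + integral {0..t} y) \<and>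
    (AE t in lebesgue_on {0..T}. y t \<in> F t (x t)) \<and>
    x 0 = (\<Sum>i\<in>J. \<alpha> i *\<^sub>R x (\<tau> i))"
proof -
  have mi: "m integrable_on {0..T}" using m by (rule integrable_on_lebesgue_on) simp
  define \<rho> where "\<rho> = R + 1"
  define r where "r = closest_point (cball (0::'b) \<rho>)"
  have ball: "convex (cball (0::'b) \<rho>)" "closed (cball (0::'b) \<rho>)" "cball (0::'b) \<rho> \<noteq> {}"
    using \<open>0 < R\<close> by (auto simp: \<rho>_def)
  define \<delta> where "\<delta> k = 1 / real (Suc k)" for k
  have \<delta>: "0 < \<delta> k" "\<delta> k \<le> 1" for k by (auto simp: \<delta>_def)
  have \<delta>_lim: "\<delta> \<longlonglongrightarrow> 0" unfolding \<delta>_def[abs_def] by (rule LIMSEQ_Suc[OF lim_1_over_n])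
  define M where "M = integral {0..T} m"
  define approx where "approx k u x \<longleftrightarrow> u \<in> borel_measurable (lebesgue_on {0..T}) \<and>
    (\<forall>t\<in>{0..T}. norm (u t) \<le> m t) \<and>
    (\<forall>t\<in>{0..T}. x t = x 0 + integral {0..t} u) \<and>
    (\<forall>t\<in>{0..T}. norm (x t) \<le> \<rho> + \<delta> k + 2 * \<delta> k / \<rho> * M) \<and>
    x 0 = r (\<Sum>i\<in>J. \<alpha> i *\<^sub>R x (\<tau> i)) \<and>
    (\<forall>t\<in>{0..T}. u t \<in> convex hull (\<Union>z\<in>ball (r (x t)) (2 * \<delta> k). F t z))" for k u x
  have "\<exists>u x. approx k u x" for k
    unfolding approx_def \<rho>_def r_def M_def
    by (rule nonlocal_approximate_solution) (fact meas comp conv ne guide mi bound \<delta> \<open>0 \<le> T\<close> \<open>0 < R\<close> \<tau>)+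
  then obtain u x where approx: "\<And>k. approx k (u k) (x k)" by metis
  then have u_meas: "u k \<in> borel_measurable (lebesgue_on {0..T})"
    and u_bound: "t \<in> {0..T} \<Longrightarrow> norm (u k t) \<le> m t"
    and x_u: "t \<in> {0..T} \<Longrightarrow> x k t = x k 0 + integral {0..t} (u k)"
    and x_bound: "t \<in> {0..T} \<Longrightarrow> norm (x k t) \<le> \<rho> + \<delta> k + 2 * \<delta> k / \<rho> * M"
    and x_0: "x k 0 = r (\<Sum>i\<in>J. \<alpha> i *\<^sub>R x k (\<tau> i))"
    and u_hull: "t \<in> {0..T} \<Longrightarrow> u k t \<in> convex hull (\<Union>z\<in>ball (r (x k t)) (2 * \<delta> k). F t z)"
    for k t
    unfolding approx_def by blast+
  have m_int: "m integrable_on {a..b}" if "0 \<le> a" "b \<le> T" for a b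
    by (rule integrable_subinterval_real[OF mi]) (use that in auto)
  have u_int: "u k integrable_on {a..b}" if "0 \<le> a" "b \<le> T" for k a b
  proof -
    have "u k integrable_on {0..T}"
      by (rule measurable_bounded_by_integrable_imp_integrable[OF u_meas mi u_bound]) auto
    then show ?thesis by (rule integrable_subinterval_real) (use that in auto)
  qed
  have "0 \<le> M" unfolding M_def
    using m_pos by (intro Henstock_Kurzweil_Integration.integral_nonneg mi) (auto simp: less_imp_le)
  \<comment> \<open>The increments of \<open>\<Phi>\<close> dominate those of every approximate
    solution, so its continuity gives equicontinuity.\<close>
  define \<Phi> where "\<Phi> t = integral {0..t} m" for t
  have x_diff: "norm (x k b - x k a) \<le> \<Phi> b - \<Phi> a" if "a \<in> {0..T}" "b \<in> {0..T}" "a \<le> b" for k a b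
  proof -
    have "integral {0..a} (u k) + integral {a..b} (u k) = integral {0..b} (u k)"
      using that u_int by (intro Henstock_Kurzweil_Integration.integral_combine) auto
    then have "x k b - x k a = integral {a..b} (u k)"
      using x_u[OF that(1), of k] x_u[OF that(2), of k] by (simp add: algebra_simps)
    moreover have "norm (integral {a..b} (u k)) \<le> integral {a..b} m"
      using that u_bound
      by (intro Henstock_Kurzweil_Integration.integral_norm_bound_integral u_int m_int) auto
    moreover have "integral {0..a} m + integral {a..b} m = integral {0..b} m"
      using that m_int by (intro Henstock_Kurzweil_Integration.integral_combine) auto
    ultimately show ?thesis by (simp add: \<Phi>_def)
  qed
  have x_diff': "norm (x k a - x k b) \<le> \<bar>\<Phi> b - \<Phi> a\<bar>" if "a \<in> {0..T}" "b \<in> {0..T}" for k a b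
    using x_diff[of a b k] x_diff[of b a k] that by (cases "a \<le> b") (auto simp: norm_minus_commute)
  have \<Phi>_cont: "continuous_on {0..T} \<Phi>"
    unfolding \<Phi>_def[abs_def] using mi by (rule indefinite_integral_continuous_1)
  have x_norm: "norm (x k t) \<le> \<rho> + 1 + 2 / \<rho> * M" if "t \<in> {0..T}" for k t
  proof -
    have "2 * \<delta> k / \<rho> * M \<le> 2 / \<rho> * M"
      using \<delta>[of k] \<open>0 < R\<close> \<open>0 \<le> M\<close> by (intro mult_right_mono divide_right_mono) (auto simp: \<rho>_def)
    then show ?thesis
      using x_bound[OF that, of k] \<delta>(2)[of k] by linarith
  qed
  have x_equi: "\<exists>d>0. \<forall>n s. s \<in> {0..T} \<and> norm (t - s) < d \<longrightarrow> norm (x n t - x n s) < e"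
    if t: "t \<in> {0..T}" and "0 < e" for t e
  proof -
    obtain d where "d > 0" and d: "\<forall>s\<in>{0..T}. dist s t < d \<longrightarrow> dist (\<Phi> s) (\<Phi> t) < e"
      using \<Phi>_cont t \<open>0 < e\<close> unfolding continuous_on_iff by blast
    have "norm (x n t - x n s) < e" if "s \<in> {0..T}" "norm (t - s) < d" for n s
    proof -
      have "dist (\<Phi> s) (\<Phi> t) < e"
        using d that by (simp add: dist_real_def abs_minus_commute)
      then show ?thesis using x_diff'[OF t that(1), of n] by (simp add: dist_real_def)
    qed
    then show ?thesis using \<open>d > 0\<close> by blast
  qed
  have "\<exists>X. \<exists>\<kappa>::nat \<Rightarrow> nat. strict_mono \<kappa> \<and>
    (\<forall>e>0. \<exists>N. \<forall>n t. n \<ge> N \<and> t \<in> {0..T} \<longrightarrow> norm (x (\<kappa> n) t - X t) < e)"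
  proof (rule Arzela_Ascoli)
    fix g and k :: "nat \<Rightarrow> nat"
    assume sm: "strict_mono k"
      and conv: "\<And>e. 0 < e \<Longrightarrow> \<exists>N. \<forall>n t. n \<ge> N \<and> t \<in> {0..T} \<longrightarrow> norm (x (k n) t - g t) < e"
    show ?thesis
      by (rule exI[of _ g], rule exI[of _ k]) (use sm conv in blast)
  qed (fact compact_Icc x_norm x_equi)+
  then obtain X and \<kappa> :: "nat \<Rightarrow> nat" where "strict_mono \<kappa>"
    and X: "\<And>e. 0 < e \<Longrightarrow> \<exists>N. \<forall>n t. n \<ge> N \<and> t \<in> {0..T} \<longrightarrow> norm (x (\<kappa> n) t - X t) < e"
    by blast
  have X_lim: "(\<lambda>n. x (\<kappa> n) t) \<longlonglongrightarrow> X t" if "t \<in> {0..T}" for t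
    unfolding LIMSEQ_iff using X that by blast
  have \<delta>_lim': "(\<lambda>n. \<delta> (\<kappa> n)) \<longlonglongrightarrow> 0"
    using LIMSEQ_subseq_LIMSEQ[OF \<delta>_lim \<open>strict_mono \<kappa>\<close>] by (simp add: o_def)
  have X_ball: "X t \<in> cball 0 \<rho>" if "t \<in> {0..T}" for t
  proof -
    have "(\<lambda>n. \<rho> + \<delta> (\<kappa> n) + 2 * \<delta> (\<kappa> n) / \<rho> * M) \<longlonglongrightarrow> \<rho> + 0 + 2 * 0 / \<rho> * M"
      using \<open>0 < R\<close> by (intro tendsto_intros \<delta>_lim') (auto simp: \<rho>_def)
    then have "norm (X t) \<le> \<rho> + 0 + 2 * 0 / \<rho> * M"
      using x_bound[OF that] by (intro LIMSEQ_le[OF tendsto_norm[OF X_lim[OF that]]]) auto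
    then show ?thesis by simp
  qed
  have X_0: "X 0 = (\<Sum>i\<in>J. \<alpha> i *\<^sub>R X (\<tau> i))"
  proof -
    have "(\<lambda>n. \<Sum>i\<in>J. \<alpha> i *\<^sub>R x (\<kappa> n) (\<tau> i)) \<longlonglongrightarrow> (\<Sum>i\<in>J. \<alpha> i *\<^sub>R X (\<tau> i))"
      by (intro tendsto_intros X_lim \<tau>)
    moreover have "isCont r v" for v
      unfolding r_def by (rule continuous_at_closest_point[OF ball])
    ultimately have "(\<lambda>n. r (\<Sum>i\<in>J. \<alpha> i *\<^sub>R x (\<kappa> n) (\<tau> i))) \<longlonglongrightarrow> r (\<Sum>i\<in>J. \<alpha> i *\<^sub>R X (\<tau> i))"
      by (rule isCont_tendsto_compose[rotated])
    then have "X 0 = r (\<Sum>i\<in>J. \<alpha> i *\<^sub>R X (\<tau> i))"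
      using X_lim[of 0] \<open>0 \<le> T\<close> unfolding x_0[symmetric] by (intro LIMSEQ_unique) auto
    moreover have "norm (\<Sum>i\<in>J. \<alpha> i *\<^sub>R X (\<tau> i)) \<le> \<rho>"
    proof -
      have "norm (\<Sum>i\<in>J. \<alpha> i *\<^sub>R X (\<tau> i)) \<le> (\<Sum>i\<in>J. \<bar>\<alpha> i\<bar> * \<rho>)"
        using X_ball \<tau> by (intro sum_norm_le) (auto intro!: mult_left_mono)
      also have "\<dots> \<le> 1 * \<rho>"
        using \<alpha> \<open>0 < R\<close> unfolding sum_distrib_right[symmetric]
        by (intro mult_right_mono) (auto simp: \<rho>_def)
      finally show ?thesis by simp
    qed
    ultimately show ?thesis by (simp add: r_def closest_point_self)
  qed
  have "\<exists>g y. (\<forall>k. g k \<in> midpoint_hull ((\<lambda>n. u (\<kappa> n)) ` {k..})) \<and>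
      (AE t in lebesgue_on {0..T}. (\<lambda>k. g k t) \<longlonglongrightarrow> y t)"
    using u_meas u_bound m m_pos by (intro midpoint_hull_tails_AE_convergent) auto
  then obtain g y where g: "\<And>k. g k \<in> midpoint_hull ((\<lambda>n. u (\<kappa> n)) ` {k..})"
    and g_lim: "AE t in lebesgue_on {0..T}. (\<lambda>k. g k t) \<longlonglongrightarrow> y t"
    by blast
  have "AE t in lebesgue_on {0..T}. (\<lambda>k. g k t) \<longlonglongrightarrow> y t \<and> upper_semicontinuous (F t)"
    using g_lim usc by eventually_elim auto
  then have "\<exists>N. negligible N \<and> (\<forall>t\<in>{0..T}. t \<notin> N \<longrightarrow>
      (\<lambda>k. g k t) \<longlonglongrightarrow> y t \<and> upper_semicontinuous (F t))"
    by (rule AE_lebesgue_on_imp_negligible) simp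
  then obtain N where N: "negligible N"
    and off_N: "\<And>t. t \<in> {0..T} \<Longrightarrow> t \<notin> N \<Longrightarrow> (\<lambda>k. g k t) \<longlonglongrightarrow> y t \<and> upper_semicontinuous (F t)"
    by blast
  have g_bound: "norm (g k t) \<le> m t" if "t \<in> {0..T}" for k t
    using midpoint_hull_in_convex[OF g, of k t "cball 0 (m t)"] u_bound[OF that] by auto
  \<comment> \<open>Resetting to 0 on the exceptional set makes the convergence hold at every point,
    as dominated convergence is applied here, and changes no integral.\<close>
  define g' where "g' k t = (if t \<in> N then 0 else g k t)" for k t
  define y' where "y' t = (if t \<in> N then 0 else y t)" for t
  have g'_bound: "norm (g' k t) \<le> m t" if "t \<in> {0..T}" for k t
    using g_bound[OF that] m_pos[OF that] by (auto simp: g'_def)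
  have g'_lim: "(\<lambda>k. g' k t) \<longlonglongrightarrow> y' t" if "t \<in> {0..T}" for t
    using off_N[OF that] by (auto simp: g'_def y'_def)
  \<comment> \<open>Since \<open>g k\<close> combines only derivatives from the tail starting at
    \<open>k\<close>, an error bound valid for all \<open>n \<ge> k\<close> passes to its
    integral.\<close>
  have g_integral: "g k integrable_on {0..t} \<and> norm (integral {0..t} (g k) - (X t - X 0)) \<le> \<epsilon>"
    if t: "t \<in> {0..T}" and \<epsilon>: "\<And>n. n \<ge> k \<Longrightarrow> norm ((x (\<kappa> n) t - x (\<kappa> n) 0) - (X t - X 0)) \<le> \<epsilon>" for k t \<epsilon>
  proof (rule midpoint_hull_integral[OF g])
    fix h assume "h \<in> (\<lambda>n. u (\<kappa> n)) ` {k..}"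
    then obtain n where "n \<ge> k" "h = u (\<kappa> n)" by auto
    then show "h integrable_on {0..t} \<and> norm (integral {0..t} h - (X t - X 0)) \<le> \<epsilon>"
      using \<epsilon>[of n] x_u[OF t, of "\<kappa> n"] u_int t by auto
  qed
  have close: "\<exists>K. \<forall>k\<ge>K. norm ((x (\<kappa> k) t - x (\<kappa> k) 0) - (X t - X 0)) \<le> \<epsilon>"
    if "t \<in> {0..T}" "\<epsilon> > 0" for t \<epsilon>
  proof -
    have "(\<lambda>k. x (\<kappa> k) t - x (\<kappa> k) 0) \<longlonglongrightarrow> X t - X 0"
      using X_lim that \<open>0 \<le> T\<close> by (intro tendsto_diff) auto
    then show ?thesis using that(2) unfolding LIMSEQ_iff by (meson less_imp_le)
  qed
  have g_int: "g k integrable_on {0..T}" for k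
  proof (rule measurable_bounded_by_integrable_imp_integrable[OF _ mi g_bound])
    show "g k \<in> borel_measurable (lebesgue_on {0..T})"
      using midpoint_hull_measurable[OF g] u_meas by blast
  qed auto
  have g'_eq: "integral {0..t} (g' k) = integral {0..t} (g k)" for k t
    by (rule integral_spike[OF N]) (auto simp: g'_def)
  have g'_int: "g' k integrable_on {0..t}" if "t \<in> {0..T}" for k t
  proof -
    have "g k integrable_on {0..t}"
      by (rule integrable_subinterval_real[OF g_int]) (use that in auto)
    then show ?thesis by (rule integrable_spike[OF _ N]) (auto simp: g'_def)
  qed
  have y'_lim: "y' integrable_on {0..t}" "(\<lambda>k. integral {0..t} (g' k)) \<longlonglongrightarrow> integral {0..t} y'"
    if t: "t \<in> {0..T}" for t
  proof -
    have "m integrable_on {0..t}" using t by (intro m_int) auto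
    then show "y' integrable_on {0..t}" "(\<lambda>k. integral {0..t} (g' k)) \<longlonglongrightarrow> integral {0..t} y'"
      using g'_bound g'_lim t
      by (auto intro!: dominated_convergence[where f = g' and h = m] g'_int)
  qed
  have y'_bound: "norm (y' t) \<le> m t" if "t \<in> {0..T}" for t
    using LIMSEQ_le_const2[OF tendsto_norm[OF g'_lim[OF that]]] g'_bound[OF that] by blast
  show ?thesis
  proof (rule exI[of _ X], rule exI[of _ y'], intro conjI ballI)
    have "y' integrable_on {0..T}" using y'_lim(1)[of T] \<open>0 \<le> T\<close> by auto
    then show "y' absolutely_integrable_on {0..T}"
      using absolutely_integrable_integrable_bound[OF y'_bound _ mi] by blast
    show "X t = X 0 + integral {0..t} y'" if t: "t \<in> {0..T}" for t
    proof -
      have "(\<lambda>k. integral {0..t} (g' k)) \<longlonglongrightarrow> X t - X 0"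
        unfolding LIMSEQ_iff
      proof (intro allI impI)
        fix e :: real assume "e > 0"
        then obtain K where K: "\<And>k. k \<ge> K \<Longrightarrow> norm ((x (\<kappa> k) t - x (\<kappa> k) 0) - (X t - X 0)) \<le> e / 2"
          using close[OF t, of "e / 2"] by auto
        have "norm (integral {0..t} (g' k) - (X t - X 0)) < e" if "k \<ge> K" for k
          using g_integral[OF t, of k "e / 2"] K that \<open>e > 0\<close> unfolding g'_eq by fastforce
        then show "\<exists>K. \<forall>k\<ge>K. norm (integral {0..t} (g' k) - (X t - X 0)) < e" by blast
      qed
      then have "X t - X 0 = integral {0..t} y'" using y'_lim(2)[OF t] by (rule LIMSEQ_unique)
      then show ?thesis by (simp add: algebra_simps)
    qed
    show "X 0 = (\<Sum>i\<in>J. \<alpha> i *\<^sub>R X (\<tau> i))" by (rule X_0)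
    have mem: "y t \<in> F t (X t)" if t: "t \<in> {0..T}" "t \<notin> N" for t
    proof -
      have Fcl: "closed (F t (X t))" using comp[OF t(1)] by (rule compact_imp_closed)
      have "infdist (y t) (F t (X t)) \<le> \<epsilon>" if "\<epsilon> > 0" for \<epsilon>
      proof -
        \<comment> \<open>The open \<open>\<epsilon>\<close>-neighbourhood of
          \<open>F t (X t)\<close> is written as a Minkowski sum, which shows that it is open and
          convex. Convexity lets it absorb both the hull containing \<open>u\<close> and the
          midpoint combinations.\<close>
        define U where "U = (\<Union>a\<in>F t (X t). \<Union>b\<in>ball 0 \<epsilon>. {a + b})"
        have "open U" "convex U"
          unfolding U_def by (auto intro!: open_sums convex_sums conv t)
        have "F t (X t) \<subseteq> U"
        proof
          fix a assume "a \<in> F t (X t)"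
          then show "a \<in> U" unfolding U_def using \<open>\<epsilon> > 0\<close> by (intro UN_I[of a] UN_I[of 0]) auto
        qed
        moreover have "open {z. F t z \<subseteq> U}"
          using off_N[OF t] \<open>open U\<close> by (auto simp: upper_semicontinuous_def)
        ultimately obtain \<eta> where "\<eta> > 0" and \<eta>: "ball (X t) \<eta> \<subseteq> {z. F t z \<subseteq> U}"
          using open_contains_ball by blast
        \<comment> \<open>\<open>\<eta> / 2\<close> for the centre and
          \<open>2 * (\<eta> / 4)\<close> for the radius keep the ball used for \<open>u\<close>
          inside the \<open>\<eta>\<close>-ball around \<open>X t\<close>.\<close>
        have "\<forall>\<^sub>F n in sequentially. dist (x (\<kappa> n) t) (X t) < \<eta> / 2"
          using X_lim[OF t(1)] \<open>\<eta> > 0\<close> by (intro tendstoD) auto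
        moreover have "\<forall>\<^sub>F n in sequentially. \<delta> (\<kappa> n) < \<eta> / 4"
          using \<delta>_lim' \<open>\<eta> > 0\<close> by (intro order_tendstoD) auto
        ultimately have "\<forall>\<^sub>F n in sequentially. u (\<kappa> n) t \<in> U"
        proof eventually_elim
          case (elim n)
          \<comment> \<open>The projection fixes the limit and is nonexpansive, so the projected
            points converge to \<open>X t\<close> as well.\<close>
          have "r (X t) = X t" unfolding r_def by (rule closest_point_self[OF X_ball[OF t(1)]])
          then have "dist (r (x (\<kappa> n) t)) (X t) < \<eta> / 2"
            using closest_point_lipschitz[OF ball, of "x (\<kappa> n) t" "X t"] elim(1) unfolding r_def by simp
          then have "ball (r (x (\<kappa> n) t)) (2 * \<delta> (\<kappa> n)) \<subseteq> ball (X t) \<eta>"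
            using elim(2) by (subst ball_subset_ball_iff) auto
          then have "(\<Union>z\<in>ball (r (x (\<kappa> n) t)) (2 * \<delta> (\<kappa> n)). F t z) \<subseteq> U"
            using \<eta> by blast
          then have "convex hull (\<Union>z\<in>ball (r (x (\<kappa> n) t)) (2 * \<delta> (\<kappa> n)). F t z) \<subseteq> U"
            using \<open>convex U\<close> by (rule hull_minimal)
          then show ?case using u_hull[OF t(1)] by blast
        qed
        then obtain K where K: "\<And>n. n \<ge> K \<Longrightarrow> u (\<kappa> n) t \<in> U"
          by (auto simp: eventually_sequentially)
        have "infdist (g k t) (F t (X t)) \<le> \<epsilon>" if "k \<ge> K" for k
        proof -
          have "g k t \<in> U"
            by (rule midpoint_hull_in_convex[OF g _ \<open>convex U\<close>]) (use K that in auto)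
          then obtain a b where ab: "a \<in> F t (X t)" "norm b < \<epsilon>" "g k t = a + b"
            unfolding U_def by auto
          then show ?thesis using infdist_le2[OF ab(1), of "g k t" \<epsilon>] by (simp add: dist_norm)
        qed
        moreover have "(\<lambda>k. infdist (g k t) (F t (X t))) \<longlonglongrightarrow> infdist (y t) (F t (X t))"
          using off_N[OF t] by (intro tendsto_infdist) auto
        ultimately show ?thesis by (intro LIMSEQ_le_const2) auto
      qed
      then have "infdist (y t) (F t (X t)) = 0"
        using infdist_nonneg[of "y t" "F t (X t)"] by (meson field_le_epsilon order_antisym dense_ge)
      then show ?thesis using in_closed_iff_infdist_zero[OF Fcl ne[OF t(1)]] by blast
    qed
    have "N \<inter> {0..T} \<in> null_sets (lebesgue_on {0..T})"
      using negligible_Int[OF disjI1[OF N]] by (simp add: null_sets_restrict_space negligible_iff_null_sets)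
    then show "AE t in lebesgue_on {0..T}. y' t \<in> F t (X t)"
      by (rule AE_I') (use mem in \<open>auto simp: y'_def\<close>)
  qed
qed

theorem theorem4:
  fixes T :: real and n :: nat and \<tau> \<alpha> :: "nat \<Rightarrow> real"
    and F :: "real \<Rightarrow> real^'n \<Rightarrow> (real^'n) set"
  assumes "T > 0" and "n \<ge> 1"
    and "\<forall>i\<in>{1..n}. 0 < \<tau> i \<and> \<tau> i \<le> T" and "strict_mono_on {1..n} \<tau>"
    and "(\<Sum>i=1..n. \<bar>\<alpha> i\<bar>) \<le> 1" and "(\<Sum>i=1..n. \<alpha> i) \<noteq> 1"
    and "caratheodory_map {0..T} F"
    and "\<exists>V. monotone_potential V \<and> coercive V \<and> weakly_negatively_guiding {0..T} F V"
  shows "\<exists>x. abs_continuous_on {0..T} x \<and> solves_inclusion {0..T} F x \<and>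
           x 0 = (\<Sum>i=1..n. \<alpha> i *\<^sub>R x (\<tau> i))"
proof -
  have F: "F t z \<noteq> {}" "convex (F t z)" "compact (F t z)" if "t \<in> {0..T}" for t z
    using assms(7) that unfolding caratheodory_map_def by blast+
  have meas: "{t\<in>{0..T}. F t z \<subseteq> A} \<in> sets lebesgue" if "closed A" for z A
    using assms(7) that unfolding caratheodory_map_def by blast
  have usc: "AE t in lebesgue_on {0..T}. upper_semicontinuous (F t)"
    using assms(7) unfolding caratheodory_map_def by blast
  obtain \<mu> where \<mu>: "integrable (lebesgue_on {0..T}) \<mu>"
    and growth: "\<And>t z. t \<in> {0..T} \<Longrightarrow> (SUP y\<in>F t z. norm y) \<le> \<mu> t * (1 + norm z)"
    using assms(7) unfolding caratheodory_map_def by blast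
  obtain R where "R > 0" and guide: "\<And>z t. norm z \<ge> R \<Longrightarrow> t \<in> {0..T} \<Longrightarrow> \<exists>y\<in>F t z. z \<bullet> y \<le> 0"
  proof -
    obtain V where "monotone_potential V" "weakly_negatively_guiding {0..T} F V"
      using assms(8) by blast
    then show thesis by (rule guiding_inner_le_0) (rule that; blast)
  qed
  have y_le: "norm y \<le> \<mu> t * (1 + norm z)" if "t \<in> {0..T}" "y \<in> F t z" for t z y
  proof -
    \<comment> \<open>A supremum of reals dominates the elements only if the set is bounded above;
      compactness supplies this, and the growth condition then bounds each \<open>y\<close>.\<close>
    have "bdd_above (norm ` F t z)"
      using compact_imp_bounded[OF F(3)[OF that(1)]] by (auto simp: bounded_iff bdd_above_def)
    then have "norm y \<le> (SUP y\<in>F t z. norm y)" using that(2) by (rule cSUP_upper[rotated])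
    then show ?thesis using growth[OF that(1)] order_trans by blast
  qed
  have \<mu>_nonneg: "0 \<le> \<mu> t" if t: "t \<in> {0..T}" for t
  proof -
    obtain y where "y \<in> F t 0" using F(1)[OF t] by blast
    from order_trans[OF norm_ge_zero y_le[OF t this]] show ?thesis by simp
  qed
  \<comment> \<open>\<open>R + 2\<close> bounds \<open>1 + norm z\<close> on the ball of radius
    \<open>R + 1\<close>. The summand 1 makes \<open>m\<close> strictly positive, as required of a
    function that serves as a weight in a denominator.\<close>
  define m where "m t = \<mu> t * (R + 2) + 1" for t
  have bound: "norm y \<le> m t" if "t \<in> {0..T}" "z \<in> cball 0 (R + 1)" "y \<in> F t z" for t z y
  proof -
    have "\<mu> t * (1 + norm z) \<le> \<mu> t * (R + 2)"
      using \<mu>_nonneg[OF that(1)] that(2) by (intro mult_left_mono) auto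
    then show ?thesis using y_le[OF that(1,3)] by (simp add: m_def)
  qed
  have m_pos: "0 < m t" if "t \<in> {0..T}" for t
    using \<mu>_nonneg[OF that] \<open>R > 0\<close> by (simp add: m_def add_nonneg_pos)
  have m: "integrable (lebesgue_on {0..T}) m"
    unfolding m_def using \<mu> by auto
  have \<tau>: "\<tau> i \<in> {0..T}" if "i \<in> {1..n}" for i
    using assms(1,3) that by (auto simp: less_imp_le)
  have "\<exists>x y. y absolutely_integrable_on {0..T} \<and>
    (\<forall>t\<in>{0..T}. x t = x 0 + integral {0..t} y) \<and>
    (AE t in lebesgue_on {0..T}. y t \<in> F t (x t)) \<and>
    x 0 = (\<Sum>i=1..n. \<alpha> i *\<^sub>R x (\<tau> i))"
    by (rule guided_nonlocal_solution)
      (fact meas F usc guide m m_pos bound less_imp_le[OF assms(1)] \<open>R > 0\<close> \<tau> assms(5))+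
  then obtain x y where y: "y absolutely_integrable_on {0..T}"
    and x: "\<And>t. t \<in> {0..T} \<Longrightarrow> x t = x 0 + integral {0..t} y"
    and incl: "AE t in lebesgue_on {0..T}. y t \<in> F t (x t)"
    and x_0: "x 0 = (\<Sum>i=1..n. \<alpha> i *\<^sub>R x (\<tau> i))"
    by blast
  have "solves_inclusion {0..T} F x"
    unfolding solves_inclusion_def
  proof -
    have "y integrable_on {0..T}" using y by (rule absolutely_integrable_on_def[THEN iffD1, THEN conjunct1])
    from AE_has_vector_derivative_indefinite_integral[OF this] incl AE_space
    show "AE t in lebesgue_on {0..T}. \<exists>y\<in>F t (x t). (x has_vector_derivative y) (at t within {0..T})"
    proof eventually_elim
      case (elim t)
      have "((\<lambda>s. x 0 + integral {0..s} y) has_vector_derivative 0 + y t) (at t within {0..T})"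
        by (intro has_vector_derivative_add has_vector_derivative_const elim)
      then have D: "((\<lambda>s. x 0 + integral {0..s} y) has_vector_derivative y t) (at t within {0..T})"
        by simp
      have "t \<in> {0..T}" using elim(3) by simp
      then have "(x has_vector_derivative y t) (at t within {0..T})"
        by (rule has_vector_derivative_transform[OF _ x D])
      then show ?case using elim(2) by blast
    qed
  qed
  moreover have "abs_continuous_on {0..T} x"
    using y x by (rule abs_continuous_on_indefinite_integral)
  ultimately show ?thesis using x_0 by blast
qed

end
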